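(* Let $\sigma\in\mathfrak{S}_n$ and let $A=\{a_1,\dots,a_n\}$. Then $$\mathbf{F}_\sigma(A)=\underline{\pi}_{\omega}(A_\sigma),$$ where $A_\sigma$ is the smallest word on $A$, for the lexicographic order, whose standardized word is $\sigma^{-1}$, and $\underline{\pi}_\omega$ denotes the (lifted) quasi-symmetrizing action of $\pi_\omega\in H_n(0)$ on $\mathbb{K}\langle A\rangle$.
   Context: $\mathbb{K}$ is a field of characteristic $0$, and $A=\{a_1<\dots<a_n\}$ is a totally ordered alphabet of noncommuting letters; $\mathbb{K}\langle A\rangle$ is the free associative algebra. Standardization: for a word $w$ of length $m$ over a totally ordered alphabet, $\mathrm{std}(w)\in\mathfrak{S}_m$ is the permutation (written as a word) obtained by labelling the occurrences of the smallest letter from left to right by $1,2,\dots$, then continuing with the occurrences of the next letter from left to right, and so on. Permutations are written as words $\sigma=\sigma(1)\cdots\sigma(n)$. $\mathbf{F}_\sigma(A)=\sum_{w\in A^*,\ \mathrm{std}(w)=\sigma^{-1}} w$. $H_n(0)$ is the degenerate Hecke algebra, generated by $\pi_1,\dots,\pi_{n-1}$ subject to the braid relations ($\pi_i\pi_{i+1}\pi_i=\pi_{i+1}\pi_i\pi_{i+1}$, $\pi_i\pi_j=\pi_j\pi_i$ for $|i-j|>1$) and $\pi_i^2=\pi_i$. $\omega=(n,n-1,\dots,1)$ is the longest element of $\mathfrak{S}_n$, and $\pi_\omega=\pi_{i_1}\cdots\pi_{i_N}$ for any reduced word $s_{i_1}\cdots s_{i_N}$ of $\omega$, $s_i$ being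 the elementary transpositions. Quasi-symmetrizing action on $\mathbb{K}\langle A\rangle$: for a word $w$, $|w|_i$ is the number of occurrences of $a_i$ in $w$. For $0\le k\le |w|_i$, $w(a_i\uparrow k)$ is the word obtained by replacing the last $k$ letters $a_i$ of $w$ by $a_{i+1}$, and $w(a_{i}\downarrow k)$ is the word obtained by replacing the first $k$ letters $a_{i}$ of $w$ by $a_{i-1}$. The action of $\pi_i$, denoted $\underline{\pi}_i$, is the linear map given on words by: - $\underline{\pi}_i(w)=w$ if $|w|_i=|w|_{i+1}=0$, or if $|w|_i\ne 0$ and $|w|_{i+1}\neq 0$; - $\underline{\pi}_i(w)=\sum_{k=0}^{|w|_i} w(a_i\uparrow k)$ if $|w|_i\neq 0$ and $|w|_{i+1}=0$; - $\underline{\pi}_i(w)=-\sum_{k=1}^{|w|_{i+1}-1} w(a_{i+1}\downarrow k)$ if $|w|_i=0$ and $|w|_{i+1}\neq 0$. These operators define an action of $H_n(0)$ on $\mathbb{K}\langle A\rangle$ (the lift to words, preserving standardization, of the quasi-symmetrizing action on $\mathbb{K}[x_1,\dots,x_n]$), and $\underline{\pi}_\omega$ is the operator by which $\pi_\omega$ acts. *)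

theory Defs
  imports
    "HOL-Library.Poly_Mapping"
    "HOL-Library.List_Lexorder"
    "HOL-Combinatorics.Permutations"
    "HOL-Algebra.QuotRing"
begin

section \<open>Words and free associative algebras\<close>

text \<open>Words form the free monoid under concatenation. With this instance, the convolution product
  of \<^theory>\<open>HOL-Library.Poly_Mapping\<close> makes \<open>'a list \<Rightarrow>\<^sub>0 'k\<close> the free associative algebra on the
  letters \<open>'a\<close>.\<close>

instantiation list :: (type) monoid_add
begin

definition zero_list :: "'a list" where "zero_list = []"

definition plus_list :: "'a list \<Rightarrow> 'a list \<Rightarrow> 'a list" where "plus_list u v = u @ v"

instance by standard (simp_all add: zero_list_def plus_list_def)

end

abbreviation word :: "'a list \<Rightarrow> 'a list \<Rightarrow>\<^sub>0 'k::field_char_0" where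
  "word w \<equiv> Poly_Mapping.single w 1"

abbreviation scalar :: "'k::field_char_0 \<Rightarrow> 'a list \<Rightarrow>\<^sub>0 'k" where
  "scalar c \<equiv> Poly_Mapping.single [] c"

definition linear_extension ::
  "('a list \<Rightarrow> 'b list \<Rightarrow>\<^sub>0 'k) \<Rightarrow> ('a list \<Rightarrow>\<^sub>0 'k) \<Rightarrow> ('b list \<Rightarrow>\<^sub>0 'k::field_char_0)" where
  "linear_extension T f = (\<Sum>w\<in>Poly_Mapping.keys f. scalar (Poly_Mapping.lookup f w) * T w)"

definition free_algebra :: "'a set \<Rightarrow> ('a list \<Rightarrow>\<^sub>0 'k::field_char_0) ring" where
  "free_algebra X =
     \<lparr>carrier = {f. Poly_Mapping.keys f \<subseteq> lists X}, mult = (*), one = 1, zero = 0, add = (+)\<rparr>"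


section \<open>Standardization and the functions F\<close>

text \<open>The label of the occurrence at position \<open>p\<close> is one more than the number of occurrences
  labelled before it: those of smaller letters, and those of the same letter further to the left.
  List positions start at 0, labels at 1.\<close>

definition std :: "'a::linorder list \<Rightarrow> nat list" where
  "std w = map (\<lambda>p. Suc (card {q. q < length w \<and> (w ! q < w ! p \<or> w ! q = w ! p \<and> q < p)}))
             [0..<length w]"

definition one_line :: "nat \<Rightarrow> (nat \<Rightarrow> nat) \<Rightarrow> nat list" where
  "one_line n \<sigma> = map \<sigma> [1..<Suc n]"

text \<open>\<open>inv_into UNIV \<sigma>\<close> is the inverse permutation; the syntax \<open>inv\<close> is taken by HOL-Algebra.\<close>

definition std_class :: "'a::linorder set \<Rightarrow> nat \<Rightarrow> (nat \<Rightarrow> nat) \<Rightarrow> 'a list set" where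
  "std_class A n \<sigma> = {w \<in> lists A. std w = one_line n (inv_into UNIV \<sigma>)}"

text \<open>The index set is finite for finite \<open>A\<close>, as all its words have length \<open>n\<close>.\<close>

definition F_sum ::
  "'a::linorder set \<Rightarrow> nat \<Rightarrow> (nat \<Rightarrow> nat) \<Rightarrow> ('a list \<Rightarrow>\<^sub>0 'k::field_char_0)" where
  "F_sum A n \<sigma> = (\<Sum>w\<in>std_class A n \<sigma>. word w)"

text \<open>\<^const>\<open>Min\<close> refers to the lexicographic order of \<^theory>\<open>HOL-Library.List_Lexorder\<close>.\<close>

definition min_word :: "'a::linorder set \<Rightarrow> nat \<Rightarrow> (nat \<Rightarrow> nat) \<Rightarrow> 'a list" where
  "min_word A n \<sigma> = Min (std_class A n \<sigma>)"


section \<open>The degenerate Hecke algebra\<close>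

definition hecke_relations :: "nat \<Rightarrow> (nat list \<Rightarrow>\<^sub>0 'k::field_char_0) set" where
  "hecke_relations n =
     {word [i, Suc i, i] - word [Suc i, i, Suc i] | i. 1 \<le> i \<and> Suc i < n} \<union>
     {word [i, j] - word [j, i] | i j. i \<in> {1..<n} \<and> j \<in> {1..<n} \<and> \<bar>int i - int j\<bar> > 1} \<union>
     {word [i, i] - word [i] | i. i \<in> {1..<n}}"

definition hecke_ideal :: "nat \<Rightarrow> (nat list \<Rightarrow>\<^sub>0 'k::field_char_0) set" where
  "hecke_ideal n = Idl\<^bsub>free_algebra {1..<n}\<^esub> (hecke_relations n)"

definition hecke :: "nat \<Rightarrow> (nat list \<Rightarrow>\<^sub>0 'k::field_char_0) set ring" where
  "hecke n = free_algebra {1..<n} Quot hecke_ideal n"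

definition hecke_gen :: "nat \<Rightarrow> nat \<Rightarrow> (nat list \<Rightarrow>\<^sub>0 'k::field_char_0) set" where
  "hecke_gen n i = hecke_ideal n +>\<^bsub>free_algebra {1..<n}\<^esub> word [i]"

definition hecke_prod :: "nat \<Rightarrow> nat list \<Rightarrow> (nat list \<Rightarrow>\<^sub>0 'k::field_char_0) set" where
  "hecke_prod n r = foldr (\<lambda>i x. hecke_gen n i \<otimes>\<^bsub>hecke n\<^esub> x) r \<one>\<^bsub>hecke n\<^esub>"

definition perm_of_word :: "nat list \<Rightarrow> nat \<Rightarrow> nat" where
  "perm_of_word r = foldr (\<lambda>i \<tau>. transpose i (Suc i) \<circ> \<tau>) r id"

definition reduced_word :: "nat \<Rightarrow> (nat \<Rightarrow> nat) \<Rightarrow> nat list \<Rightarrow> bool" where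
  "reduced_word n \<sigma> r \<longleftrightarrow> r \<in> lists {1..<n} \<and> perm_of_word r = \<sigma> \<and>
     (\<forall>r' \<in> lists {1..<n}. perm_of_word r' = \<sigma> \<longrightarrow> length r \<le> length r')"

definition longest_perm :: "nat \<Rightarrow> nat \<Rightarrow> nat" where
  "longest_perm n i = (if i \<in> {1..n} then Suc n - i else i)"


section \<open>The quasi-symmetrizing action\<close>

text \<open>The letter \<open>a\<^sub>i\<close> is the number \<open>i\<close>. The operators are defined by the same formulas on all words
  of natural numbers; for \<open>1 \<le> i < n\<close> they preserve the span of the words over \<open>{1..n}\<close>.\<close>

primrec replace_first :: "'a \<Rightarrow> 'a \<Rightarrow> nat \<Rightarrow> 'a list \<Rightarrow> 'a list" where
  "replace_first a b k [] = []"
| "replace_first a b k (x # w) =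
     (if x = a \<and> k > 0 then b # replace_first a b (k - 1) w else x # replace_first a b k w)"

definition replace_last :: "'a \<Rightarrow> 'a \<Rightarrow> nat \<Rightarrow> 'a list \<Rightarrow> 'a list" where
  "replace_last a b k w = rev (replace_first a b k (rev w))"

definition raise :: "nat \<Rightarrow> nat \<Rightarrow> nat list \<Rightarrow> nat list" where
  "raise i k w = replace_last i (i + 1) k w"

definition lower :: "nat \<Rightarrow> nat \<Rightarrow> nat list \<Rightarrow> nat list" where
  "lower i k w = replace_first i (i - 1) k w"

definition qsym_word :: "nat \<Rightarrow> nat list \<Rightarrow> (nat list \<Rightarrow>\<^sub>0 'k::field_char_0)" where
  "qsym_word i w =
     (if count_list w i \<noteq> 0 \<and> count_list w (i + 1) = 0
        then (\<Sum>k = 0..count_list w i. word (raise i k w))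
      else if count_list w i = 0 \<and> count_list w (i + 1) \<noteq> 0
        then - (\<Sum>k = 1..count_list w (i + 1) - 1. word (lower (i + 1) k w))
      else word w)"

definition qsym_op :: "nat \<Rightarrow> (nat list \<Rightarrow>\<^sub>0 'k) \<Rightarrow> (nat list \<Rightarrow>\<^sub>0 'k::field_char_0)" where
  "qsym_op i = linear_extension (qsym_word i)"

definition free_act ::
  "(nat list \<Rightarrow>\<^sub>0 'k) \<Rightarrow> (nat list \<Rightarrow>\<^sub>0 'k) \<Rightarrow> (nat list \<Rightarrow>\<^sub>0 'k::field_char_0)" where
  "free_act p f = linear_extension (\<lambda>r. foldr qsym_op r f) p"

text \<open>An element of the quotient acts through any of its representatives. Because of \<^const>\<open>the_elem\<close>,
  the value is determined only when all representatives act in the same way on \<open>f\<close>, so a statement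
  about it entails that the action is well defined there.\<close>

definition hecke_act ::
  "(nat list \<Rightarrow>\<^sub>0 'k) set \<Rightarrow> (nat list \<Rightarrow>\<^sub>0 'k) \<Rightarrow> (nat list \<Rightarrow>\<^sub>0 'k::field_char_0)" where
  "hecke_act C f = the_elem ((\<lambda>p. free_act p f) ` C)"

end

theory Submission
  imports Defs HOL.Modules
begin

text \<open>The operators become transparent in another basis of the free algebra. For a word \<open>u\<close>, let
  \<open>particle u\<close> be the sum of the words obtained from \<open>u\<close> by lowering letters so that an
  occurrence of a letter \<open>x\<close> stays above the next smaller letter of \<open>u\<close>, the occurrences of \<open>x\<close> remain
  weakly increasing from left to right, and one of them keeps the value \<open>x\<close> (\<open>particle_words\<close>). These
  sums lift the fundamental particles of quasisymmetric function theory to words. They are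
  unitriangular with respect to the words and hence span. The lemma \<open>qsym_op_particle\<close> shows that
  \<open>\<pi>\<^sub>i\<close> acts on them through the set of letters of \<open>u\<close> only: if \<open>i\<close> occurs and \<open>Suc i\<close> does not, it
  adds the particle in which \<open>i\<close> is renamed to \<open>Suc i\<close>; if \<open>Suc i\<close> occurs and \<open>i\<close> does not, it gives
  zero; otherwise it fixes the particle.

  The first consequence is that the Hecke relations can be checked on particles by going through
  the possible sets of letters. So the ideal of relations acts as zero, and a product of generators
  acts as the corresponding product of operators (\<open>hecke_act_hecke_prod\<close>).

  The second consequence is a rule for sums. Let \<open>order_ideal t\<close> be the set of words with positive
  letters that are ordered like \<open>t\<close> and lie below \<open>t\<close> in every position. Then \<open>\<pi>\<^sub>i\<close> takes the sum of
  the particles over \<open>order_ideal t\<close> to the sum over \<open>order_ideal (raise_step i t)\<close>, where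
  \<open>raise_step\<close> renames \<open>i\<close> to \<open>Suc i\<close> if this enlarges \<open>t\<close> (\<open>qsym_op_order_ideal\<close>). This is the usual
  behaviour of Demazure operators on lower Bruhat intervals, here for subsets of \<open>{1..n}\<close>. Along a
  reduced word, the exchange condition shows that a set of letters that is closed downwards
  is moved exactly by the permutation (\<open>set_foldr_raise_step\<close>).

  The smallest word \<open>A\<^sub>\<sigma>\<close> of the standardization class uses an initial segment of letters, because
  its letters increase only where \<open>\<sigma>\<close> has a descent. It is therefore its own particle, and the only
  member of its order ideal. The longest element moves its letters to the top of \<open>{1..n}\<close>, so that
  the order ideal becomes the set of all words over \<open>{1..n}\<close> ordered like \<open>A\<^sub>\<sigma>\<close>
  (\<open>foldr_qsym_op_longest\<close>). The supports of their particles partition the standardization class,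
  the particle of a member being found from its maxima on the blocks of equal letters of \<open>A\<^sub>\<sigma>\<close>
  (\<open>sum_particles_eq_F_sum\<close>).\<close>

section \<open>Linear operators on the free algebra\<close>

lemma zero_eq_Nil: "(0 :: 'a list) = []"
  by (simp add: zero_list_def)

lemma plus_eq_append: "(u :: 'a list) + v = u @ v"
  by (simp add: plus_list_def)

lemma lookup_scalar_mult [simp]:
  "Poly_Mapping.lookup (scalar c * f) w = c * Poly_Mapping.lookup f w"
  by (simp add: mult_map_scale_conv_mult [symmetric] zero_eq_Nil [symmetric] map.rep_eq when_def)

lemma scalar_mult_word: "scalar c * word w = Poly_Mapping.single w c"
  by (simp add: mult_single plus_eq_append)

lemma scalar_mult_scalar: "scalar c * scalar d = scalar (c * d)"
  by (simp add: mult_single plus_eq_append)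

lemma scalar_1: "scalar 1 = 1"
  by (simp add: zero_eq_Nil [symmetric])

text \<open>Scalars are multiples of the empty word, hence central.\<close>

lemma mult_scalar_commute: "f * (scalar c * g) = scalar c * (f * (g :: 'a list \<Rightarrow>\<^sub>0 'k::field_char_0))"
proof -
  have "f * scalar c = scalar c * f"
  proof (induction f rule: update_induct)
    case const
    then show ?case by simp
  next
    case (update f w d)
    have "Poly_Mapping.update w d f = Poly_Mapping.single w d + f"
      by (rule poly_mapping_eqI)
        (use update in \<open>auto simp: lookup_update lookup_add lookup_single when_def in_keys_iff\<close>)
    then show ?case
      using update by (simp add: distrib_left distrib_right mult_single plus_eq_append mult.commute)
  qed
  then show ?thesis
    by (metis mult.assoc)
qed

lemma words_span [case_names zero step]:
  fixes f :: "'a list \<Rightarrow>\<^sub>0 'k::field_char_0"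
  assumes "P 0" and "\<And>w c f. P f \<Longrightarrow> P (scalar c * word w + f)"
  shows "P f"
proof (induction f rule: update_induct)
  case const
  then show ?case by (rule assms(1))
next
  case (update f w c)
  have "Poly_Mapping.update w c f = scalar c * word w + f"
    by (rule poly_mapping_eqI)
      (use update in \<open>auto simp: lookup_update lookup_add lookup_single when_def in_keys_iff
          scalar_mult_word\<close>)
  then show ?case
    using assms(2) [OF update(3)] by simp
qed

locale linear_op = additive G for G :: "('a list \<Rightarrow>\<^sub>0 'k::field_char_0) \<Rightarrow> ('b list \<Rightarrow>\<^sub>0 'k)" +
  assumes scale: "G (scalar c * f) = scalar c * G f"

lemma linear_op_id: "linear_op (\<lambda>f. f)"
  by unfold_locales auto

lemma linear_op_comp:
  assumes "linear_op G" "linear_op H"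
  shows "linear_op (\<lambda>f. G (H f))"
proof -
  interpret G: linear_op G by fact
  interpret H: linear_op H by fact
  show ?thesis
    by unfold_locales (simp_all add: G.add H.add G.scale H.scale)
qed

lemma linear_op_add:
  assumes "linear_op G" "linear_op H"
  shows "linear_op (\<lambda>f. G f + H f)"
proof -
  interpret G: linear_op G by fact
  interpret H: linear_op H by fact
  show ?thesis
    by unfold_locales (simp_all add: G.add H.add G.scale H.scale algebra_simps)
qed

lemma linear_op_scalar_mult:
  assumes "linear_op G"
  shows "linear_op (\<lambda>f. scalar c * G f)"
proof -
  interpret G: linear_op G by fact
  show ?thesis
    by unfold_locales
      (simp_all add: G.add G.scale algebra_simps scalar_mult_scalar flip: mult.assoc)
qed

lemma linear_op_zero: "linear_op (\<lambda>f. 0)"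
  by unfold_locales auto

lemma linear_op_eqI:
  assumes "linear_op G" "linear_op H" and eq: "\<And>w. G (word w) = H (word w)"
  shows "G f = H f"
proof -
  interpret G: linear_op G by fact
  interpret H: linear_op H by fact
  show ?thesis
    by (induction f rule: words_span) (simp_all add: G.zero H.zero G.add H.add G.scale H.scale eq)
qed

lemma linear_extension_superset:
  assumes "finite S" "Poly_Mapping.keys f \<subseteq> S"
  shows "linear_extension T f = (\<Sum>w\<in>S. scalar (Poly_Mapping.lookup f w) * T w)"
  unfolding linear_extension_def
  by (rule sum.mono_neutral_left) (use assms in \<open>auto simp: in_keys_iff\<close>)

lemma linear_extension_word: "linear_extension T (word w) = T w"
  by (simp add: linear_extension_def scalar_1)

lemma linear_op_linear_extension:
  fixes T :: "'a list \<Rightarrow> 'b list \<Rightarrow>\<^sub>0 'k::field_char_0"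
  shows "linear_op (linear_extension T)"
proof unfold_locales
  fix f g :: "'a list \<Rightarrow>\<^sub>0 'k" and c :: 'k
  have "Poly_Mapping.keys (f + g) \<subseteq> Poly_Mapping.keys f \<union> Poly_Mapping.keys g"
    by (rule Poly_Mapping.keys_add)
  then show "linear_extension T (f + g) = linear_extension T f + linear_extension T g"
    by (simp add: linear_extension_superset [of "Poly_Mapping.keys f \<union> Poly_Mapping.keys g"]
        lookup_add single_add distrib_right sum.distrib)
  have "Poly_Mapping.keys (scalar c * f) \<subseteq> Poly_Mapping.keys f"
    by (auto simp: in_keys_iff)
  then show "linear_extension T (scalar c * f) = scalar c * linear_extension T f"
    by (simp add: linear_extension_superset [of "Poly_Mapping.keys f"]
        sum_distrib_left scalar_mult_scalar flip: mult.assoc)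
qed

lemma linear_op_qsym_op: "linear_op (qsym_op i)"
  unfolding qsym_op_def by (rule linear_op_linear_extension)

lemma qsym_op_word: "qsym_op i (word w) = qsym_word i w"
  by (simp add: qsym_op_def linear_extension_word)

lemma linear_op_foldr_qsym: "linear_op (foldr qsym_op r)"
proof (induction r)
  case Nil
  then show ?case using linear_op_id by (simp add: id_def)
next
  case (Cons i r)
  then show ?case
    using linear_op_comp [OF linear_op_qsym_op] by (simp add: comp_def)
qed

section \<open>The action of the free algebra on the generators\<close>

lemma free_act_word: "free_act (word r) f = foldr qsym_op r f"
  by (simp add: free_act_def linear_extension_word)

lemma linear_op_free_act_left: "linear_op (\<lambda>p. free_act p f)"
  unfolding free_act_def by (rule linear_op_linear_extension)

lemma linear_op_free_act_right:
  fixes p :: "nat list \<Rightarrow>\<^sub>0 'k::field_char_0"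
  shows "linear_op (free_act p)"
proof (induction p rule: words_span)
  case zero
  interpret linear_op "\<lambda>p. free_act p f" for f by (rule linear_op_free_act_left)
  have "free_act (0 :: nat list \<Rightarrow>\<^sub>0 'k) = (\<lambda>f. 0)" by (auto simp: zero)
  then show ?case by (simp add: linear_op_zero)
next
  case (step w c p)
  interpret linear_op "\<lambda>p. free_act p f" for f by (rule linear_op_free_act_left)
  have "free_act (scalar c * word w + p) = (\<lambda>f. scalar c * foldr qsym_op w f + free_act p f)"
    by (auto simp: add scale free_act_word)
  then show ?case
    using step by (simp add: linear_op_add linear_op_scalar_mult linear_op_foldr_qsym)
qed

lemma free_act_mult:
  fixes p q f :: "nat list \<Rightarrow>\<^sub>0 'k::field_char_0"
  shows "free_act (p * q) f = free_act p (free_act q f)"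
proof -
  note lin = linear_op_free_act_left linear_op_free_act_right
  have step: "free_act (word u * q) f = free_act (word u) (free_act q f)" for u
  proof -
    have "linear_op (\<lambda>q. word u * (q :: nat list \<Rightarrow>\<^sub>0 'k))"
      by unfold_locales (simp_all add: distrib_left mult_scalar_commute)
    from linear_op_comp [OF lin(1) this] linear_op_comp [OF lin(2) lin(1)]
    show ?thesis
      by (rule linear_op_eqI) (simp add: mult_single plus_eq_append free_act_word)
  qed
  have "linear_op (\<lambda>p. p * q)"
    by unfold_locales (simp_all add: distrib_right mult.assoc)
  from linear_op_comp [OF lin(1) this] lin(1)
  show ?thesis
    by (rule linear_op_eqI) (rule step)
qed

section \<open>Passage to the degenerate Hecke algebra\<close>

lemma ring_free_algebra:
  "ring (free_algebra X :: ('a list \<Rightarrow>\<^sub>0 'k::field_char_0) ring)" (is "ring ?R")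
proof (intro ringI abelian_groupI monoidI)
  fix f g :: "'a list \<Rightarrow>\<^sub>0 'k"
  assume fg: "f \<in> carrier ?R" "g \<in> carrier ?R"
  then show "f \<oplus>\<^bsub>?R\<^esub> g \<in> carrier ?R"
    using Poly_Mapping.keys_add [of f g] by (auto simp: free_algebra_def)
  have "Poly_Mapping.keys (f * g) \<subseteq>
      {u + v |u v. u \<in> Poly_Mapping.keys f \<and> v \<in> Poly_Mapping.keys g}"
    by (rule keys_mult)
  with fg show "f \<otimes>\<^bsub>?R\<^esub> g \<in> carrier ?R"
    by (fastforce simp: free_algebra_def plus_eq_append)
next
  show "\<one>\<^bsub>?R\<^esub> \<in> carrier ?R"
    by (simp add: free_algebra_def zero_eq_Nil flip: single_one)
  fix f :: "'a list \<Rightarrow>\<^sub>0 'k"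
  assume f: "f \<in> carrier ?R"
  then show "\<exists>g\<in>carrier ?R. g \<oplus>\<^bsub>?R\<^esub> f = \<zero>\<^bsub>?R\<^esub>"
    by (intro bexI [of _ "- f"]) (auto simp: free_algebra_def)
qed (auto simp: free_algebra_def algebra_simps)

lemma subgroup_add_monoid_free_algebraI:
  fixes I :: "('a list \<Rightarrow>\<^sub>0 'k::field_char_0) set"
  assumes "I \<subseteq> carrier (free_algebra X)" and "0 \<in> I"
    and "\<And>f g. f \<in> I \<Longrightarrow> g \<in> I \<Longrightarrow> f + g \<in> I" and "\<And>f. f \<in> I \<Longrightarrow> - f \<in> I"
  shows "subgroup I (add_monoid (free_algebra X))"
proof -
  let ?R = "free_algebra X :: ('a list \<Rightarrow>\<^sub>0 'k) ring"
  interpret ring ?R by (rule ring_free_algebra)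
  have minus: "\<ominus>\<^bsub>?R\<^esub> f = - f" if "f \<in> I" for f
    by (rule minus_equality) (use that assms in \<open>auto simp: free_algebra_def\<close>)
  show ?thesis
  proof (rule group.subgroupI [OF a_group])
    show "I \<noteq> {}" using assms(2) by auto
  qed (use assms minus in \<open>auto simp: free_algebra_def a_inv_def\<close>)
qed

text \<open>The kernel of a representation is a two-sided ideal, so that it contains the ideal generated by
  any set of relations that it contains.\<close>

lemma ideal_annihilator:
  "ideal {p \<in> carrier (free_algebra X). \<forall>f. free_act p f = 0}
     (free_algebra X :: (nat list \<Rightarrow>\<^sub>0 'k::field_char_0) ring)"
  (is "ideal ?I ?R")
proof (rule idealI)
  interpret R: ring ?R by (rule ring_free_algebra)
  interpret L: linear_op "\<lambda>p. free_act p f" for f :: "nat list \<Rightarrow>\<^sub>0 'k"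
    by (rule linear_op_free_act_left)
  interpret M: linear_op "free_act p" for p :: "nat list \<Rightarrow>\<^sub>0 'k"
    by (rule linear_op_free_act_right)
  have R_simps: "\<zero>\<^bsub>?R\<^esub> = 0" "f \<oplus>\<^bsub>?R\<^esub> g = f + g" "f \<otimes>\<^bsub>?R\<^esub> g = f * g" for f g
    by (simp_all add: free_algebra_def)
  show "ring ?R" by (rule ring_free_algebra)
  show "subgroup ?I (add_monoid ?R)"
  proof (rule subgroup_add_monoid_free_algebraI)
    show "0 \<in> ?I"
      using R.zero_closed by (auto simp: R_simps L.zero)
    show "f + g \<in> ?I" if "f \<in> ?I" "g \<in> ?I" for f g
      using that R.a_closed [of f g] by (auto simp: R_simps L.add)
    show "- f \<in> ?I" if "f \<in> ?I" for f
      using that by (auto simp: free_algebra_def L.minus)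
  qed auto
  fix p q
  assume "p \<in> ?I" "q \<in> carrier ?R"
  then show "q \<otimes>\<^bsub>?R\<^esub> p \<in> ?I" "p \<otimes>\<^bsub>?R\<^esub> q \<in> ?I"
    using R.m_closed [of p q] R.m_closed [of q p] by (auto simp: R_simps free_act_mult M.zero)
qed

lemma hecke_relations_carrier:
  "(hecke_relations n :: (nat list \<Rightarrow>\<^sub>0 'k::field_char_0) set) \<subseteq> carrier (free_algebra {1..<n})"
proof -
  have diff: "word u - word v \<in> carrier (free_algebra {1..<n} :: (nat list \<Rightarrow>\<^sub>0 'k) ring)"
    if "u \<in> lists {1..<n}" "v \<in> lists {1..<n}" for u v
    using that Poly_Mapping.keys_diff [of "word u :: nat list \<Rightarrow>\<^sub>0 'k" "word v"]
    by (auto simp: free_algebra_def)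
  show ?thesis
    unfolding hecke_relations_def by (auto intro!: diff simp del: One_nat_def)
qed

lemma ideal_hecke_ideal:
  "ideal (hecke_ideal n) (free_algebra {1..<n} :: (nat list \<Rightarrow>\<^sub>0 'k::field_char_0) ring)"
  unfolding hecke_ideal_def
  by (rule ring.genideal_ideal [OF ring_free_algebra hecke_relations_carrier])

lemma word_in_free_algebra: "word r \<in> carrier (free_algebra X) \<longleftrightarrow> r \<in> lists X"
  by (simp add: free_algebra_def)

lemma hecke_prod_eq_coset:
  assumes "r \<in> lists {1..<n}"
  shows "(hecke_prod n r :: (nat list \<Rightarrow>\<^sub>0 'k::field_char_0) set) =
    hecke_ideal n +>\<^bsub>free_algebra {1..<n}\<^esub> word r"
  using assms
proof (induction r rule: lists.induct)
  case Nil
  then show ?case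
    by (simp add: hecke_prod_def hecke_def FactRing_def free_algebra_def zero_eq_Nil
        flip: single_one)
next
  case (Cons i r)
  let ?R = "free_algebra {1..<n} :: (nat list \<Rightarrow>\<^sub>0 'k) ring"
  have step: "(hecke_prod n (i # r) :: (nat list \<Rightarrow>\<^sub>0 'k) set) =
      rcoset_mult ?R (hecke_ideal n) (hecke_gen n i) (hecke_prod n r)"
    by (simp add: hecke_prod_def hecke_def FactRing_def)
  have "word [i] \<in> carrier ?R" "word r \<in> carrier ?R"
    unfolding word_in_free_algebra using Cons.hyps by auto
  then have "hecke_prod n (i # r) = hecke_ideal n +>\<^bsub>?R\<^esub> (word [i] \<otimes>\<^bsub>?R\<^esub> word r)"
    unfolding step hecke_gen_def Cons.IH by (rule ideal.rcoset_mult_add [OF ideal_hecke_ideal])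
  also have "word [i] \<otimes>\<^bsub>?R\<^esub> word r = word (i # r)"
    by (simp add: free_algebra_def mult_single plus_eq_append)
  finally show ?case .
qed

text \<open>All representatives of the coset of \<open>r\<close> differ by elements of the ideal, which act as zero, so
  the value does not depend on the representative and can be computed from the word \<open>r\<close> itself.\<close>

lemma hecke_act_hecke_prod:
  fixes f :: "nat list \<Rightarrow>\<^sub>0 'k::field_char_0"
  assumes "r \<in> lists {1..<n}"
    and relations: "\<And>p g :: nat list \<Rightarrow>\<^sub>0 'k. p \<in> hecke_relations n \<Longrightarrow> free_act p g = 0"
  shows "hecke_act (hecke_prod n r) f = foldr qsym_op r f"
proof -
  let ?R = "free_algebra {1..<n} :: (nat list \<Rightarrow>\<^sub>0 'k) ring"
  let ?C = "hecke_prod n r :: (nat list \<Rightarrow>\<^sub>0 'k) set"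
  interpret R: ring ?R by (rule ring_free_algebra)
  interpret L: linear_op "\<lambda>p. free_act p f" by (rule linear_op_free_act_left)
  have "hecke_ideal n \<subseteq> {p \<in> carrier ?R. \<forall>f. free_act p f = 0}"
    unfolding hecke_ideal_def
    by (rule R.genideal_minimal [OF ideal_annihilator])
      (use hecke_relations_carrier relations in auto)
  then have kill: "free_act a f = 0" if "a \<in> hecke_ideal n" for a
    using that by auto
  have C: "?C = (\<lambda>a. a + word r) ` hecke_ideal n"
    unfolding hecke_prod_eq_coset [OF assms(1)] a_r_coset_def'
    by (auto simp: free_algebra_def)
  have "0 \<in> hecke_ideal n"
    using additive_subgroup.zero_closed [OF ideal.axioms(1) [OF ideal_hecke_ideal]]
    by (simp add: free_algebra_def)
  then have "(\<lambda>p. free_act p f) ` ?C = {foldr qsym_op r f}"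
    unfolding C by (force simp: image_image L.add kill free_act_word)
  then show ?thesis
    by (simp add: hecke_act_def)
qed

section \<open>Strings of words\<close>

text \<open>Identifying the letters \<open>i\<close> and \<open>Suc i\<close> gives a description that is symmetric in them and does
  not mention the number \<open>k\<close> of replaced letters: for a word that misses one of the two, the string
  consists of its images under raising, or under lowering, as \<open>raise_image\<close> and \<open>lower_image\<close> show.
  Thus a word with letters \<open>i\<close> only and the word with all of them renamed share one string.\<close>

definition i_string :: "nat \<Rightarrow> nat list \<Rightarrow> nat list set" where
  "i_string i w = {v. map (\<lambda>x. if x = Suc i then i else x) v = map (\<lambda>x. if x = Suc i then i else x) w \<and>
     sorted_wrt (\<lambda>x y. \<not> (x = Suc i \<and> y = i)) v}"

definition swap :: "nat \<Rightarrow> nat list \<Rightarrow> nat list" where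
  "swap i w = map (transpose i (Suc i)) w"

lemma length_swap [simp]: "length (swap i w) = length w"
  by (simp add: swap_def)

lemma nth_swap [simp]: "p < length w \<Longrightarrow> swap i w ! p = transpose i (Suc i) (w ! p)"
  by (simp add: swap_def)

lemma in_set_swap [simp]: "x \<in> set (swap i w) \<longleftrightarrow> transpose i (Suc i) x \<in> set w"
  by (auto simp: swap_def image_iff) (metis transpose_involutory)+

lemma swap_swap [simp]: "swap i (swap i w) = w"
  by (simp add: swap_def comp_def)

lemma replace_first_0 [simp]: "replace_first a b 0 w = w"
  by (induction w) auto

lemma map_id_notin: "b \<notin> set v \<Longrightarrow> map (\<lambda>x. if x = b then a else x) v = v"
  by (induction v) auto

lemma count_replace_first:
  "a \<noteq> b \<Longrightarrow> b \<notin> set w \<Longrightarrow> k \<le> count_list w a \<Longrightarrow> count_list (replace_first a b k w) b = k"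
  by (induction w arbitrary: k) auto

lemma notin_replace_first: "a \<noteq> b \<Longrightarrow> a \<notin> set (replace_first a b (count_list w a) w)"
  by (induction w) auto

text \<open>Replacing the first occurrences leaves all new letters to the left of the remaining old ones, and a
  word with this property is determined by the original word and the number of replaced letters.\<close>

lemma replace_first_image:
  assumes "a \<noteq> b" "b \<notin> set w"
  shows "(\<lambda>k. replace_first a b k w) ` {0..count_list w a} =
    {v. map (\<lambda>x. if x = b then a else x) v = w \<and> sorted_wrt (\<lambda>x y. \<not> (x = a \<and> y = b)) v}"
    (is "?L w = ?R w")
  using assms(2)
proof (induction w)
  case Nil
  then show ?case by auto
next
  case (Cons x w)
  then have IH: "?L w = ?R w" and b: "b \<noteq> x" "b \<notin> set w" by auto
  show ?case
  proof (cases "x = a")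
    case True
    have "{0..count_list (x # w) a} = insert 0 (Suc ` {0..count_list w a})"
      using True by (auto simp: image_Suc_atLeastAtMost)
    then have "?L (x # w) = (\<lambda>k. replace_first a b k (x # w)) ` insert 0 (Suc ` {0..count_list w a})"
      by (rule arg_cong)
    also have "\<dots> = insert (a # w) ((#) b ` ?L w)"
      unfolding image_insert image_image using True by simp
    also have "\<dots> = ?R (x # w)"
    proof -
      have "v \<in> insert (a # w) ((#) b ` ?R w) \<longleftrightarrow> v \<in> ?R (a # w)" for v
      proof (cases v)
        case (Cons y v')
        have "map (\<lambda>x. if x = b then a else x) w = w" "b \<notin> set v' \<Longrightarrow> map (\<lambda>x. if x = b then a else x) v' = v'"
          using b by (auto intro: map_id_notin)
        moreover have "sorted_wrt (\<lambda>x y. \<not> (x = a \<and> y = b)) w"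
          using b(2) by (induction w) auto
        ultimately show ?thesis using Cons b assms(1) True by auto
      qed auto
      then show ?thesis unfolding IH True by (simp only: set_eq_iff simp_thms)
    qed
    finally show ?thesis .
  next
    case False
    then have "replace_first a b k (x # w) = x # replace_first a b k w" for k
      by simp
    moreover have "count_list (x # w) a = count_list w a"
      using False by simp
    ultimately have "?L (x # w) = (#) x ` ?L w"
      by (simp only: image_image)
    also have "\<dots> = ?R (x # w)"
    proof -
      have "v \<in> (#) x ` ?R w \<longleftrightarrow> v \<in> ?R (x # w)" for v
      proof (cases v)
        case (Cons y v')
        have "y # v' \<in> (#) x ` ?R w \<longleftrightarrow> y = x \<and> v' \<in> ?R w" by blast
        moreover have "(if y = b then a else y) = x \<longleftrightarrow> y = x" using False b(1) by auto
        moreover have "sorted_wrt (\<lambda>x y. \<not> (x = a \<and> y = b)) (x # v') \<longleftrightarrow>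
            sorted_wrt (\<lambda>x y. \<not> (x = a \<and> y = b)) v'"
          using False by simp
        ultimately show ?thesis using Cons by auto
      qed auto
      then show ?thesis unfolding IH by (simp only: set_eq_iff simp_thms)
    qed
    finally show ?thesis .
  qed
qed

lemma map_fuse_flip:
  "map (\<lambda>x. if x = b then a else x) v = map (\<lambda>x. if x = b then a else x) w \<longleftrightarrow>
   map (\<lambda>x. if x = a then b else x) v = map (\<lambda>x. if x = a then b else x) (w :: 'a list)"
proof -
  have "(if x = b then a else x) = (if y = b then a else y) \<longleftrightarrow>
      (if x = a then b else x) = (if y = a then b else y)" for x y :: 'a
    by auto
  then show ?thesis
    by (simp only: list_eq_iff_nth_eq length_map nth_map cong: conj_cong imp_cong)
qed

lemma raise_image:
  assumes "Suc i \<notin> set w"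
  shows "(\<lambda>k. raise i k w) ` {0..count_list w i} = i_string i w"
proof -
  have "(\<lambda>k. raise i k w) ` {0..count_list w i} =
      rev ` (\<lambda>k. replace_first i (Suc i) k (rev w)) ` {0..count_list (rev w) i}"
    by (simp add: raise_def replace_last_def image_image)
  also have "(\<lambda>k. replace_first i (Suc i) k (rev w)) ` {0..count_list (rev w) i} =
      {v. map (\<lambda>x. if x = Suc i then i else x) v = rev w \<and>
        sorted_wrt (\<lambda>x y. \<not> (x = i \<and> y = Suc i)) v}"
    by (rule replace_first_image) (use assms in auto)
  also have "rev ` \<dots> = {v. map (\<lambda>x. if x = Suc i then i else x) v = w \<and>
        sorted_wrt (\<lambda>x y. \<not> (x = Suc i \<and> y = i)) v}" (is "rev ` ?A = ?B")
  proof -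
    have "rev v \<in> ?A \<longleftrightarrow> v \<in> ?B" for v
      by (auto simp: rev_map [symmetric] sorted_wrt_rev elim!: sorted_wrt_mono_rel [rotated])
    moreover have "v \<in> rev ` A \<longleftrightarrow> rev v \<in> A" for v and A :: "nat list set"
      by (metis imageI image_iff rev_rev_ident)
    ultimately show ?thesis by (simp only: set_eq_iff simp_thms)
  qed
  also have "\<dots> = i_string i w"
    using assms by (simp add: i_string_def map_id_notin)
  finally show ?thesis .
qed

lemma lower_image:
  assumes "i \<notin> set w"
  shows "(\<lambda>k. lower (Suc i) k w) ` {0..count_list w (Suc i)} = i_string i w"
  using assms
  by (simp add: lower_def replace_first_image i_string_def map_fuse_flip [of "Suc i" i]
      map_id_notin)

lemma inj_on_replace_first:
  assumes "a \<noteq> b" "b \<notin> set w"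
  shows "inj_on (\<lambda>k. replace_first a b k w) {0..count_list w a}"
  by (rule inj_on_inverseI [of _ "\<lambda>v. count_list v b"]) (simp add: count_replace_first assms)

lemma inj_on_raise:
  assumes "Suc i \<notin> set w"
  shows "inj_on (\<lambda>k. raise i k w) {0..count_list w i}"
  using inj_on_replace_first [of i "Suc i" "rev w"] assms
  by (auto simp: raise_def replace_last_def inj_on_def)

lemma inj_on_lower:
  assumes "i \<notin> set w"
  shows "inj_on (\<lambda>k. lower (Suc i) k w) {0..count_list w (Suc i)}"
  using inj_on_replace_first [of "Suc i" i w] assms
  by (auto simp: lower_def)

lemma finite_i_string:  "finite (i_string i w)"
proof -
  have "i_string i w \<subseteq> {v. set v \<subseteq> set w \<union> {i, Suc i} \<and> length v = length w}"
  proof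
    fix v assume v: "v \<in> i_string i w"
    let ?f = "\<lambda>x. if x = Suc i then i else x"
    have fuse: "map ?f v = map ?f w"
      using v by (simp add: i_string_def)
    then have "length v = length w"
      by (rule map_eq_imp_length_eq)
    moreover have "x \<in> set w \<union> {i, Suc i}" if "x \<in> set v" for x
    proof -
      have "?f ` set v = ?f ` set w"
        using arg_cong [OF fuse, of set] by simp
      then have "?f x \<in> ?f ` set w" using that by blast
      then show ?thesis by (auto split: if_splits)
    qed
    ultimately show "v \<in> {v. set v \<subseteq> set w \<union> {i, Suc i} \<and> length v = length w}"
      by blast
  qed
  then show ?thesis
    by (rule finite_subset) (simp add: finite_lists_length_eq)
qed

lemma i_string_swap: "i_string i (swap i w) = i_string i w"
proof -
  have "(\<lambda>x. if x = Suc i then i else x) (transpose i (Suc i) y) = (if y = Suc i then i else y)" for y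
    by (auto simp: transpose_def)
  then show ?thesis by (simp add: i_string_def swap_def comp_def)
qed

lemma i_string_self: "\<not> (i \<in> set w \<and> Suc i \<in> set w) \<Longrightarrow> w \<in> i_string i w"
  unfolding i_string_def by (auto simp: sorted_wrt_iff_nth_less) (metis nth_mem less_trans)

lemma i_string_without_Suc:
  assumes "i \<notin> set w" "v \<in> i_string i w" "i \<notin> set v"
  shows "v = w"
  using assms unfolding i_string_def map_fuse_flip [of "Suc i" i]
  by (simp add: map_id_notin)

lemma i_string_without_i:
  assumes "i \<notin> set w" "v \<in> i_string i w" "Suc i \<notin> set v"
  shows "v = swap i w"
proof -
  have "Suc i \<notin> set (swap i w)"
    using assms(1) by simp
  moreover have "v \<in> i_string i (swap i w)"
    using assms(2) by (simp add: i_string_swap)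
  ultimately show ?thesis
    using assms(3) unfolding i_string_def by (simp add: map_id_notin)
qed

abbreviation string_upper :: "nat \<Rightarrow> nat list \<Rightarrow> nat list set" where
  "string_upper i w \<equiv> {v \<in> i_string i w. Suc i \<in> set v}"

text \<open>A string has two ends, where only one of the two letters occurs; the operator fixes every word in
  between.\<close>

lemma i_string_split:
  assumes "i \<notin> set w" "Suc i \<in> set w"
  shows "i_string i w = insert (swap i w) (string_upper i w)"
    and "swap i w \<notin> string_upper i w"
    and "string_upper i w = insert w {v \<in> i_string i w. i \<in> set v \<and> Suc i \<in> set v}"
proof -
  have sw: "swap i w \<in> i_string i w"
  proof -
    have "swap i w \<in> i_string i (swap i w)"
      by (rule i_string_self) (use assms in auto)
    then show ?thesis by (simp add: i_string_swap)
  qed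
  then show "i_string i w = insert (swap i w) (string_upper i w)"
    using i_string_without_i [OF assms(1)] by blast
  show "swap i w \<notin> string_upper i w"
    using assms(1) by simp
  show "string_upper i w = insert w {v \<in> i_string i w. i \<in> set v \<and> Suc i \<in> set v}"
    using assms i_string_without_Suc [OF assms(1)] i_string_self [of i w] by blast
qed

lemma qsym_word_raise:
  assumes "i \<in> set w" "Suc i \<notin> set w"
  shows "qsym_word i w = (\<Sum>v\<in>i_string i w. word v)"
  using assms
  by (simp add: qsym_word_def count_list_0_iff sum.reindex [OF inj_on_raise]
      flip: raise_image)

lemma qsym_word_lower:
  assumes "i \<notin> set w" "Suc i \<in> set w"
  shows "(qsym_word i w :: nat list \<Rightarrow>\<^sub>0 'k::field_char_0) =
    - (\<Sum>v\<in>{v \<in> i_string i w. i \<in> set v \<and> Suc i \<in> set v}. word v)"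
proof -
  let ?m = "count_list w (Suc i)" and ?l = "\<lambda>k. lower (Suc i) k w"
  have m: "?m > 0" using assms by (metis count_list_0_iff gr0I)
  \<comment> \<open>Lowering no letter and lowering all of them give the two ends of the string; the sum in the
    definition runs over the rest.\<close>
  have l0: "?l 0 = w" by (simp add: lower_def)
  have "Suc i \<notin> set (?l ?m)"
    by (simp add: lower_def notin_replace_first)
  moreover have "?l ?m \<in> i_string i w"
    unfolding lower_image [OF assms(1), symmetric] by simp
  ultimately have lm: "?l ?m = swap i w"
    by (metis i_string_without_i [OF assms(1)])
  have inj: "inj_on ?l {0..?m}" using inj_on_lower assms by simp
  have "?l ` {1..?m - 1} = ?l ` ({0..?m} - {0, ?m})"
    by (rule arg_cong [of _ _ "(`) ?l"]) (use m in auto)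
  also have "\<dots> = i_string i w - {w, swap i w}"
    using m inj by (subst inj_on_image_set_diff [OF inj]) (auto simp: lower_image assms l0 lm)
  also have "\<dots> = {v \<in> i_string i w. i \<in> set v \<and> Suc i \<in> set v}"
    using i_string_split [OF assms] assms(1) by auto
  finally have img: "?l ` {1..?m - 1} = {v \<in> i_string i w. i \<in> set v \<and> Suc i \<in> set v}" .
  have inj': "inj_on ?l {1..?m - 1}"
    by (rule inj_on_subset [OF inj]) auto
  have "qsym_word i w = - (\<Sum>k = 1..?m - 1. word (?l k) :: nat list \<Rightarrow>\<^sub>0 'k)"
    using assms m by (simp add: qsym_word_def count_list_0_iff)
  also have "(\<Sum>k = 1..?m - 1. word (?l k) :: nat list \<Rightarrow>\<^sub>0 'k) = (\<Sum>v\<in>?l ` {1..?m - 1}. word v)"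
    by (simp only: sum.reindex [OF inj'] comp_def)
  finally show ?thesis unfolding img .
qed

lemma qsym_word_fixed:
  assumes "i \<in> set w \<longleftrightarrow> Suc i \<in> set w"
  shows "qsym_word i w = word w"
  using assms by (auto simp: qsym_word_def count_list_0_iff)

section \<open>The operators on sums over strings\<close>

lemma sum_qsym:
  "qsym_op i (\<Sum>v\<in>S. word (f v)) = (\<Sum>v\<in>S. qsym_word i (f v))"
proof -
  interpret linear_op "qsym_op i" by (rule linear_op_qsym_op)
  show ?thesis by (simp add: sum qsym_op_word)
qed

text \<open>The two ends of a string are exchanged by \<open>swap\<close>. The interior of the string is added at the lower
  end and subtracted at the upper one, so that it cancels.\<close>

lemma qsym_word_swap:
  fixes w :: "nat list"
  assumes "\<not> (i \<in> set w \<and> Suc i \<in> set w)"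
  shows "(qsym_word i w :: nat list \<Rightarrow>\<^sub>0 'k::field_char_0) + qsym_word i (swap i w) =
    word w + word (swap i w)"
proof -
  have *: "(qsym_word i w :: nat list \<Rightarrow>\<^sub>0 'k) + qsym_word i (swap i w) = word w + word (swap i w)"
    if w: "i \<notin> set w" "Suc i \<in> set w" for w
  proof -
    let ?B = "{v \<in> i_string i w. i \<in> set v \<and> Suc i \<in> set v}"
    have "qsym_word i (swap i w) = (\<Sum>v\<in>i_string i w. word v :: nat list \<Rightarrow>\<^sub>0 'k)"
      using qsym_word_raise [of i "swap i w"] w by (simp add: i_string_swap)
    also have "\<dots> = word (swap i w) + (word w + (\<Sum>v\<in>?B. word v))"
    proof -
      have "finite ?B" "w \<notin> ?B" using w by (simp_all add: finite_i_string)
      moreover have "swap i w \<notin> insert w ?B"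
        using i_string_split(2,3) [OF w] by simp
      moreover have "i_string i w = insert (swap i w) (insert w ?B)"
        using i_string_split(1,3) [OF w] by (simp only:)
      then have "(\<Sum>v\<in>i_string i w. word v :: nat list \<Rightarrow>\<^sub>0 'k) =
          (\<Sum>v\<in>insert (swap i w) (insert w ?B). word v)"
        by (rule arg_cong)
      ultimately show ?thesis by simp
    qed
    finally show ?thesis
      by (simp add: qsym_word_lower [OF w])
  qed
  consider "i \<notin> set w" "Suc i \<notin> set w" | "i \<notin> set w" "Suc i \<in> set w" | "i \<in> set w" "Suc i \<notin> set w"
    using assms by blast
  then show ?thesis
  proof cases
    case 1
    then show ?thesis by (simp add: qsym_word_fixed)
  next
    case 2
    then show ?thesis by (rule *)
  next
    case 3
    then show ?thesis using * [of "swap i w"] by (simp add: add.commute)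
  qed
qed

lemma qsym_op_swap_closed:
  fixes P :: "nat list set"
  assumes "finite P"
    and closed: "\<And>w. w \<in> P \<Longrightarrow> \<not> (i \<in> set w \<and> Suc i \<in> set w) \<Longrightarrow> swap i w \<in> P"
  shows "qsym_op i (\<Sum>w\<in>P. word w) = (\<Sum>w\<in>P. word w :: nat list \<Rightarrow>\<^sub>0 'k::field_char_0)"
proof -
  let ?U = "{w \<in> P. Suc i \<in> set w \<and> i \<notin> set w}" and ?D = "{w \<in> P. i \<in> set w \<and> Suc i \<notin> set w}"
    and ?F = "{w \<in> P. i \<in> set w \<longleftrightarrow> Suc i \<in> set w}"
  have bij: "bij_betw (swap i) ?U ?D"
    by (rule bij_betwI [of _ _ _ "swap i"]) (auto intro: closed)
  have split: "sum f P = sum f ?F + (\<Sum>w\<in>?U. f w + f (swap i w))"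
    for f :: "nat list \<Rightarrow> nat list \<Rightarrow>\<^sub>0 'k"
  proof -
    have "sum f P = sum f (?F \<union> (?U \<union> ?D))"
      by (rule arg_cong [of _ _ "sum f"]) auto
    also have "\<dots> = sum f ?F + (sum f ?U + sum f ?D)"
      by (subst sum.union_disjoint; (subst sum.union_disjoint)?) (use assms(1) in auto)
    also have "sum f ?D = (\<Sum>w\<in>?U. f (swap i w))"
      by (rule sum.reindex_bij_betw [OF bij, symmetric])
    finally show ?thesis by (simp add: sum.distrib)
  qed
  have "qsym_op i (\<Sum>w\<in>P. word w :: nat list \<Rightarrow>\<^sub>0 'k) =
      sum (qsym_word i) ?F + (\<Sum>w\<in>?U. qsym_word i w + qsym_word i (swap i w))"
    unfolding sum_qsym by (rule split)
  also have "\<dots> = (\<Sum>w\<in>?F. word w) + (\<Sum>w\<in>?U. word w + word (swap i w))"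
    by (rule arg_cong2 [of _ _ _ _ "(+)"]; rule sum.cong) (auto simp: qsym_word_fixed qsym_word_swap)
  also have "\<dots> = (\<Sum>w\<in>P. word w)"
    by (rule split [symmetric])
  finally show ?thesis .
qed

text \<open>The upper end is sent to minus the interior of the string, and the interior is fixed.\<close>

lemma qsym_op_string_upper:
  assumes "i \<notin> set w" "Suc i \<in> set w"
  shows "qsym_op i (\<Sum>v\<in>string_upper i w. word v :: nat list \<Rightarrow>\<^sub>0 'k::field_char_0) = 0"
proof -
  let ?B = "{v \<in> i_string i w. i \<in> set v \<and> Suc i \<in> set v}"
  have B: "finite ?B" "w \<notin> ?B" using assms by (simp_all add: finite_i_string)
  have "(\<Sum>v\<in>?B. qsym_word i v :: nat list \<Rightarrow>\<^sub>0 'k) = (\<Sum>v\<in>?B. word v)"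
    by (rule sum.cong) (auto simp: qsym_word_fixed)
  with B show ?thesis
    unfolding sum_qsym i_string_split(3) [OF assms]
    by (simp add: qsym_word_lower [OF assms])
qed

lemma qsym_word_raise_upper:
  assumes "i \<in> set w" "Suc i \<notin> set w"
  shows "qsym_word i w =
    word w + (\<Sum>v\<in>string_upper i (swap i w). word v :: nat list \<Rightarrow>\<^sub>0 'k::field_char_0)"
proof -
  have "i_string i w = insert w (string_upper i (swap i w))" "w \<notin> string_upper i (swap i w)"
    using i_string_split(1,2) [of i "swap i w"] assms by (simp_all add: i_string_swap)
  moreover from this(1) have "(\<Sum>v\<in>i_string i w. word v :: nat list \<Rightarrow>\<^sub>0 'k) =
      (\<Sum>v\<in>insert w (string_upper i (swap i w)). word v)"
    by (rule arg_cong)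
  ultimately show ?thesis
    by (simp add: qsym_word_raise [OF assms] finite_i_string)
qed

section \<open>Fundamental particles\<close>

text \<open>Since a lowered letter stays above all smaller letters of \<open>u\<close>, the condition \<open>set u \<subseteq> set v\<close> means
  that each letter of \<open>u\<close> is kept at one of its own occurrences. On the level of exponents these are
  the monomials of Searles' fundamental particles. The letter \<open>0\<close>, which operators
  of positive index never touch, is made immovable, so that the particles span all words.\<close>

definition particle_words :: "nat list \<Rightarrow> nat list set" where
  "particle_words u = {v. length v = length u \<and>
     (\<forall>p<length u. v ! p \<le> u ! p \<and> (0 < u ! p \<longrightarrow> 0 < v ! p)) \<and>
     (\<forall>p<length u. \<forall>q<length u. u ! q < u ! p \<longrightarrow> u ! q < v ! p) \<and>
     (\<forall>q<length u. \<forall>p<q. u ! p = u ! q \<longrightarrow> v ! p \<le> v ! q) \<and>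
     set u \<subseteq> set v}"

lemma particle_wordsI:
  assumes "length v = length u"
    and "\<And>p. p < length u \<Longrightarrow> v ! p \<le> u ! p"
    and "\<And>p. p < length u \<Longrightarrow> 0 < u ! p \<Longrightarrow> 0 < v ! p"
    and "\<And>p q. p < length u \<Longrightarrow> q < length u \<Longrightarrow> u ! q < u ! p \<Longrightarrow> u ! q < v ! p"
    and "\<And>p q. p < q \<Longrightarrow> q < length u \<Longrightarrow> u ! p = u ! q \<Longrightarrow> v ! p \<le> v ! q"
    and "set u \<subseteq> set v"
  shows "v \<in> particle_words u"
  using assms unfolding particle_words_def by blast

lemma particle_wordsD:
  assumes "v \<in> particle_words u"
  shows "length v = length u"
    and "p < length u \<Longrightarrow> v ! p \<le> u ! p"
    and "p < length u \<Longrightarrow> 0 < u ! p \<Longrightarrow> 0 < v ! p"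
    and "p < length u \<Longrightarrow> q < length u \<Longrightarrow> u ! q < u ! p \<Longrightarrow> u ! q < v ! p"
    and "p < q \<Longrightarrow> q < length u \<Longrightarrow> u ! p = u ! q \<Longrightarrow> v ! p \<le> v ! q"
    and "set u \<subseteq> set v"
  using assms unfolding particle_words_def by blast+

definition particle :: "nat list \<Rightarrow> (nat list \<Rightarrow>\<^sub>0 'k::field_char_0)" where
  "particle u = (\<Sum>v\<in>particle_words u. word v)"

lemma finite_particle_words: "finite (particle_words u)"
proof (rule finite_subset)
  show "particle_words u \<subseteq> {v. set v \<subseteq> {..Max (set u)} \<and> length v = length u}"
    unfolding particle_words_def
    by (auto simp: in_set_conv_nth) (meson List.finite_set Max_ge le_trans nth_mem)
  show "finite {v. set v \<subseteq> {..Max (set u)} \<and> length v = length u}"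
    by (rule finite_lists_length_eq) simp
qed

lemma self_in_particle_words: "u \<in> particle_words u"
  by (auto simp: particle_words_def)

text \<open>The conditions on \<open>v\<close> only compare letters of \<open>u\<close> and \<open>v\<close> with each other and with \<open>0\<close>.\<close>

lemma particle_words_map:
  assumes mono: "\<And>x y. x \<in> set u \<union> set v \<Longrightarrow> y \<in> set u \<union> set v \<Longrightarrow> x < y \<Longrightarrow> f x < f y"
    and zero: "\<And>x. x \<in> set u \<union> set v \<Longrightarrow> f x = 0 \<longleftrightarrow> x = 0"
    and v: "v \<in> particle_words u"
  shows "map f v \<in> particle_words (map f u)"
proof -
  note len = particle_wordsD(1) [OF v]
  have le: "f x \<le> f y" if "x \<in> set u \<union> set v" "y \<in> set u \<union> set v" "x \<le> y" for x y
    using mono [of x y] that by (cases "x = y") auto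
  have less: "f x < f y \<longleftrightarrow> x < y" if "x \<in> set u \<union> set v" "y \<in> set u \<union> set v" for x y
    using mono [OF that] le [OF that(2,1)] by (meson linorder_not_le)
  have eq: "f x = f y \<longleftrightarrow> x = y" if "x \<in> set u \<union> set v" "y \<in> set u \<union> set v" for x y
    using less [OF that] less [OF that(2,1)] by (metis less_irrefl linorder_neqE_nat)
  have mem: "u ! p \<in> set u \<union> set v" "v ! p \<in> set u \<union> set v" if "p < length u" for p
    using that len by auto
  have pos: "0 < f x \<longleftrightarrow> 0 < x" if "x \<in> set u \<union> set v" for x
    using zero [OF that] by (metis gr0I less_numeral_extra(3))
  show ?thesis
  proof (rule particle_wordsI)
    show "set (map f u) \<subseteq> set (map f v)"
      using particle_wordsD(6) [OF v] by auto
  qed (use mem particle_wordsD(1-5) [OF v] in \<open>auto simp: less eq pos intro!: le\<close>)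
qed

text \<open>On numbers that omit \<open>i\<close>, or omit \<open>Suc i\<close>, the transposition is strictly increasing.\<close>

lemma swap_in_particle_words:
  assumes "0 < i" and "v \<in> particle_words u"
    and "(i \<notin> set u \<and> i \<notin> set v) \<or> (Suc i \<notin> set u \<and> Suc i \<notin> set v)"
  shows "swap i v \<in> particle_words (swap i u)"
  unfolding swap_def
proof (rule particle_words_map [OF _ _ assms(2)])
  fix x y
  assume "x \<in> set u \<union> set v" "y \<in> set u \<union> set v" "x < y"
  then have "\<not> (x = i \<and> y = Suc i)" using assms(3) by auto
  then show "transpose i (Suc i) x < transpose i (Suc i) y"
    using \<open>x < y\<close> by (auto simp: transpose_def)
next
  fix x
  show "transpose i (Suc i) x = 0 \<longleftrightarrow> x = 0"
    using assms(1) by (auto simp: transpose_def)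
qed

lemma swap_fixed: "i \<notin> set u \<Longrightarrow> Suc i \<notin> set u \<Longrightarrow> swap i u = u"
  unfolding swap_def by (rule map_idI) (auto simp: transpose_def)

text \<open>If both letters occur in \<open>u\<close>, they occur in every word of the particle, which is then fixed. If
  neither occurs, the words of the particle come in pairs exchanged by \<open>swap\<close>.\<close>

lemma qsym_op_particle_fixed:
  assumes "0 < i" and "i \<in> set u \<longleftrightarrow> Suc i \<in> set u"
  shows "qsym_op i (particle u) = (particle u :: nat list \<Rightarrow>\<^sub>0 'k::field_char_0)"
  unfolding particle_def
proof (rule qsym_op_swap_closed)
  fix w
  assume w: "w \<in> particle_words u" "\<not> (i \<in> set w \<and> Suc i \<in> set w)"
  then have "set u \<subseteq> set w" by (simp add: particle_words_def)
  with w(2) assms(2) have "i \<notin> set u" "Suc i \<notin> set u" by auto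
  then show "swap i w \<in> particle_words u"
    using swap_in_particle_words [OF assms(1) w(1)] w(2) by (auto simp: swap_fixed)
qed (rule finite_particle_words)

text \<open>Together with the next lemma: when \<open>u\<close> has the letter \<open>Suc i\<close> but not \<open>i\<close>, the letters \<open>i\<close> and
  \<open>Suc i\<close> of a word of the particle all come from the letter \<open>Suc i\<close> of \<open>u\<close>, so that the particle is a
  disjoint union of strings without their lower ends.\<close>

lemma merge_letters_particle_words:
  assumes i: "i \<notin> set u" "Suc i \<in> set u" and v: "v \<in> particle_words u"
  shows "map (\<lambda>x. if x = i then Suc i else x) v \<in> particle_words u" (is "?w \<in> _")
    and "v \<in> i_string i (map (\<lambda>x. if x = i then Suc i else x) v)"
proof -
  note len = particle_wordsD(1) [OF v]
  have u: "u ! p \<noteq> i" if "p < length u" for p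
    using that i(1) by (metis nth_mem)
  have block: "u ! p = Suc i" if "p < length u" "v ! p = i \<or> v ! p = Suc i" for p
  proof -
    have "v ! p \<le> u ! p" using that(1) by (rule particle_wordsD(2) [OF v])
    moreover have "\<not> Suc i < u ! p"
    proof
      assume "Suc i < u ! p"
      moreover obtain q where "q < length u" "u ! q = Suc i"
        using i(2) by (auto simp: in_set_conv_nth)
      ultimately have "Suc i < v ! p"
        using particle_wordsD(4) [OF v that(1)] by metis
      with that(2) show False by auto
    qed
    ultimately show ?thesis using that u [of p] by force
  qed
  have w_nth: "?w ! p = (if v ! p = i then Suc i else v ! p)" if "p < length u" for p
    using that len by simp
  show "?w \<in> particle_words u"
  proof (rule particle_wordsI)
    show "set u \<subseteq> set ?w"
      using particle_wordsD(6) [OF v] i(1) by (auto simp: image_iff)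
    show "length ?w = length u" using len by simp
    show "?w ! p \<le> u ! p" if "p < length u" for p
      using particle_wordsD(2) [OF v that] block [OF that] w_nth [OF that] by auto
    show "0 < ?w ! p" if "p < length u" "0 < u ! p" for p
      using particle_wordsD(3) [OF v that] w_nth [OF that(1)] by auto
    show "u ! q < ?w ! p" if "p < length u" "q < length u" "u ! q < u ! p" for p q
      using particle_wordsD(4) [OF v that] w_nth [OF that(1)] by auto
    show "?w ! p \<le> ?w ! q" if "p < q" "q < length u" "u ! p = u ! q" for p q
      using particle_wordsD(5) [OF v that] particle_wordsD(2) [OF v that(2)]
        block [of p] w_nth [of p] w_nth [of q] that by (auto simp: le_Suc_eq)
  qed
  show "v \<in> i_string i ?w"
  proof -
    have "sorted_wrt (\<lambda>x y. \<not> (x = Suc i \<and> y = i)) v"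
      unfolding sorted_wrt_iff_nth_less len
    proof (intro allI impI notI, elim conjE)
      fix p q
      assume pq: "p < q" "q < length u" "v ! p = Suc i" "v ! q = i"
      then have "v ! p \<le> v ! q"
        using block [of p] block [of q] by (intro particle_wordsD(5) [OF v]) auto
      with pq show False by simp
    qed
    then show ?thesis
      by (simp add: i_string_def comp_def cong: map_cong)
  qed
qed

lemma split_letters_particle_words:
  assumes "0 < i" and "i \<notin> set u" "Suc i \<in> set u" and w: "w \<in> particle_words u" "i \<notin> set w"
    and v: "v \<in> string_upper i w"
  shows "v \<in> particle_words u" and "map (\<lambda>x. if x = i then Suc i else x) v = w"
proof -
  have wv: "map (\<lambda>x. if x = i then Suc i else x) v = w"
    using v w(2) unfolding i_string_def map_fuse_flip [of "Suc i" i] by (simp add: map_id_notin)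
  then show "map (\<lambda>x. if x = i then Suc i else x) v = w" .
  have len: "length v = length u" "length w = length u"
    using w(1) arg_cong [OF wv, of length] by (simp_all add: particle_words_def)
  have w_nth: "w ! p = (if v ! p = i then Suc i else v ! p)" if "p < length u" for p
    using that len by (simp flip: wv)
  have u: "u ! p \<noteq> i" if "p < length u" for p
    using that assms(2) by (metis nth_mem)
  have sorted: "v ! p = Suc i \<Longrightarrow> v ! q \<noteq> i" if "p < q" "q < length u" for p q
    using v that by (auto simp: i_string_def sorted_wrt_iff_nth_less len)
  have "set u \<subseteq> set v"
  proof
    fix x assume "x \<in> set u"
    then have "x \<in> set w" "x \<noteq> i" using w(1) assms(2) by (auto simp: particle_words_def)
    then show "x \<in> set v" using v by (auto simp flip: wv split: if_splits)
  qed
  moreover have "v ! p \<le> u ! p \<and> (0 < u ! p \<longrightarrow> 0 < v ! p)" if "p < length u" for p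
  proof -
    have "w ! p \<le> u ! p \<and> (0 < u ! p \<longrightarrow> 0 < w ! p)"
      using w(1) that by (simp add: particle_words_def)
    then show ?thesis using w_nth [OF that] assms(1) by (auto split: if_splits)
  qed
  moreover have "u ! q < v ! p" if "p < length u" "q < length u" "u ! q < u ! p" for p q
  proof -
    have "u ! q < w ! p" using w(1) that by (simp add: particle_words_def)
    then show ?thesis using w_nth [OF that(1)] u [OF that(2)] by (auto split: if_splits)
  qed
  moreover have "v ! p \<le> v ! q" if "p < q" "q < length u" "u ! p = u ! q" for p q
  proof -
    have "w ! p \<le> w ! q" using w(1) that by (simp add: particle_words_def)
    then show ?thesis
      using w_nth [of p] w_nth [of q] sorted [OF that(1,2)] that
      by (auto split: if_splits simp: le_Suc_eq)
  qed
  ultimately show "v \<in> particle_words u"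
    using len by (simp add: particle_words_def)
qed

lemma particle_eq_sum_strings:
  assumes "0 < i" "i \<notin> set u" "Suc i \<in> set u"
  shows "particle u = (\<Sum>w\<in>{w \<in> particle_words u. i \<notin> set w}. \<Sum>v\<in>string_upper i w. word v)"
proof -
  let ?g = "map (\<lambda>x. if x = i then Suc i else x)"
  let ?W = "{w \<in> particle_words u. i \<notin> set w}"
  have u: "Suc i \<in> set v" if "v \<in> particle_words u" for v
    using that assms(3) by (auto simp: particle_words_def)
  have fibre: "{v \<in> particle_words u. ?g v = w} = string_upper i w" if "w \<in> ?W" for w
    using that split_letters_particle_words [OF assms]
      merge_letters_particle_words [OF assms(2,3)] u by blast
  have "particle u = (\<Sum>w\<in>?W. \<Sum>v\<in>{v \<in> particle_words u. ?g v = w}. word v)"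
    unfolding particle_def
    by (rule sum.group [symmetric])
      (use merge_letters_particle_words(1) [OF assms(2,3)] in \<open>auto simp: finite_particle_words\<close>)
  also have "\<dots> = (\<Sum>w\<in>?W. \<Sum>v\<in>string_upper i w. word v)"
    by (rule sum.cong) (use fibre in auto)
  finally show ?thesis .
qed

lemma qsym_op_particle_zero:
  assumes "0 < i" "i \<notin> set u" "Suc i \<in> set u"
  shows "qsym_op i (particle u) = (0 :: nat list \<Rightarrow>\<^sub>0 'k::field_char_0)"
proof -
  interpret linear_op "qsym_op i :: (nat list \<Rightarrow>\<^sub>0 'k) \<Rightarrow> _" by (rule linear_op_qsym_op)
  have "Suc i \<in> set w" if "w \<in> particle_words u" for w
    using that assms(3) by (auto simp: particle_words_def)
  then show ?thesis
    unfolding particle_eq_sum_strings [OF assms]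
    by (subst sum) (auto intro!: sum.neutral qsym_op_string_upper)
qed

text \<open>In the words of the particle that lack \<open>Suc i\<close>, the operator adds the rest of the string. By
  \<open>particle_eq_sum_strings\<close> these rests make up the particle of \<open>swap i u\<close>.\<close>

lemma qsym_op_particle_swap:
  assumes "0 < i" "i \<in> set u" "Suc i \<notin> set u"
  shows "qsym_op i (particle u) =
    particle u + (particle (swap i u) :: nat list \<Rightarrow>\<^sub>0 'k::field_char_0)"
proof -
  let ?F = "{w \<in> particle_words u. Suc i \<in> set w}" and ?W = "{w \<in> particle_words u. Suc i \<notin> set w}"
  let ?W' = "{w \<in> particle_words (swap i u). i \<notin> set w}"
  have i: "i \<in> set w" if "w \<in> particle_words u" for w
    using that assms(2) by (auto simp: particle_words_def)
  have bij: "bij_betw (swap i) ?W ?W'"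
  proof (rule bij_betwI [of _ _ _ "swap i"])
    show "swap i \<in> ?W \<rightarrow> ?W'"
      using swap_in_particle_words [OF assms(1)] assms(3) by auto
    show "swap i \<in> ?W' \<rightarrow> ?W"
      using swap_in_particle_words [OF assms(1), of _ "swap i u"] assms(3) by auto
  qed auto
  have split: "sum f (particle_words u) = sum f ?F + sum f ?W"
    for f :: "nat list \<Rightarrow> nat list \<Rightarrow>\<^sub>0 'k"
    by (subst sum.union_disjoint [symmetric])
      (auto simp: finite_particle_words intro!: arg_cong [of _ _ "sum f"])
  have "qsym_op i (particle u) =
      (\<Sum>w\<in>?F. word w) + (\<Sum>w\<in>?W. word w + (\<Sum>v\<in>string_upper i (swap i w). word v :: nat list \<Rightarrow>\<^sub>0 'k))"
    unfolding particle_def sum_qsym split [of "qsym_word i"]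
    by (rule arg_cong2 [of _ _ _ _ "(+)"]; rule sum.cong)
      (auto simp: qsym_word_fixed qsym_word_raise_upper i)
  also have "\<dots> = particle u + (\<Sum>w\<in>?W. \<Sum>v\<in>string_upper i (swap i w). word v)"
    unfolding particle_def split [of word] by (simp add: sum.distrib add.assoc)
  also have "(\<Sum>w\<in>?W. \<Sum>v\<in>string_upper i (swap i w). word v) =
      (\<Sum>w\<in>?W'. \<Sum>v\<in>string_upper i w. word v :: nat list \<Rightarrow>\<^sub>0 'k)"
    by (rule sum.reindex_bij_betw [OF bij])
  also have "\<dots> = particle (swap i u)"
    by (rule particle_eq_sum_strings [symmetric]) (use assms in auto)
  finally show ?thesis .
qed

section \<open>The Hecke relations\<close>

text \<open>This makes the passage from words to particles unitriangular.\<close>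

lemma sum_list_particle_words:
  assumes "v \<in> particle_words u" "v \<noteq> u"
  shows "sum_list v < sum_list u"
proof -
  note len = particle_wordsD(1) [OF assms(1)] and le = particle_wordsD(2) [OF assms(1)]
  obtain p where "p < length u" "v ! p \<noteq> u ! p"
    using assms(2) len by (auto simp: list_eq_iff_nth_eq)
  then have "(\<Sum>p = 0..<length u. v ! p) < (\<Sum>p = 0..<length u. u ! p)"
    using le [of p] le by (intro sum_strict_mono_ex1 bexI [of _ p])
      (auto simp: order.strict_iff_order)
  then show ?thesis
    by (simp add: sum_list_sum_nth len)
qed

lemma linear_op_eq_particlesI:
  fixes G H :: "(nat list \<Rightarrow>\<^sub>0 'k::field_char_0) \<Rightarrow> ('b list \<Rightarrow>\<^sub>0 'k)"
  assumes "linear_op G" "linear_op H" and eq: "\<And>u. G (particle u) = H (particle u)"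
  shows "G f = H f"
proof (rule linear_op_eqI [OF assms(1,2)])
  interpret G: linear_op G by fact
  interpret H: linear_op H by fact
  fix u
  show "G (word u) = H (word u)"
  proof (induction "sum_list u" arbitrary: u rule: less_induct)
    case less
    let ?S = "particle_words u - {u}"
    have "particle u = word u + (\<Sum>v\<in>?S. word v :: nat list \<Rightarrow>\<^sub>0 'k)"
      unfolding particle_def by (rule sum.remove) (simp_all add: finite_particle_words self_in_particle_words)
    then have u: "word u = particle u - (\<Sum>v\<in>?S. word v :: nat list \<Rightarrow>\<^sub>0 'k)" by simp
    have "G (\<Sum>v\<in>?S. word v) = H (\<Sum>v\<in>?S. word v)"
      unfolding G.sum H.sum by (rule sum.cong) (auto intro: less sum_list_particle_words)
    then show ?case
      unfolding u G.diff H.diff eq by simp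
  qed
qed

lemma qsym_op_0: "qsym_op i 0 = 0"
  using additive.zero [OF linear_op.axioms(1) [OF linear_op_qsym_op]] .

lemma qsym_op_add: "qsym_op i (f + g) = qsym_op i f + qsym_op i g"
  using additive.add [OF linear_op.axioms(1) [OF linear_op_qsym_op]] .

lemma qsym_op_particle:
  assumes "0 < i"
  shows "qsym_op i (particle u) =
    (if i \<in> set u \<and> Suc i \<notin> set u then particle u + particle (swap i u)
     else if i \<notin> set u \<and> Suc i \<in> set u then 0 else particle u)"
  using assms by (simp add: qsym_op_particle_swap qsym_op_particle_zero qsym_op_particle_fixed)

lemmas linear_op_qsym_ops = linear_op_qsym_op
  linear_op_comp [OF linear_op_qsym_op linear_op_qsym_op]
  linear_op_comp [OF linear_op_qsym_op linear_op_comp [OF linear_op_qsym_op linear_op_qsym_op]]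

lemma qsym_op_idem:
  assumes "0 < i"
  shows "qsym_op i (qsym_op i f) = qsym_op i f"
proof (rule linear_op_eq_particlesI [of "\<lambda>f. qsym_op i (qsym_op i f)"])
  show "qsym_op i (qsym_op i (particle u)) = (qsym_op i (particle u) :: _ \<Rightarrow>\<^sub>0 'a)" for u
    using assms by (simp add: qsym_op_particle qsym_op_0 qsym_op_add)
qed (rule linear_op_qsym_ops)+

lemma swap_commute:
  assumes "\<bar>int i - int j\<bar> > 1"
  shows "swap i (swap j u) = swap j (swap i u)"
proof -
  have "transpose i (Suc i) (transpose j (Suc j) x) = transpose j (Suc j) (transpose i (Suc i) x)" for x
    using assms unfolding transpose_def by (cases "x = i"; cases "x = j"; cases "x = Suc i"; cases "x = Suc j") simp_all
  then show ?thesis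
    by (simp add: swap_def)
qed

lemma qsym_op_commute:
  assumes "0 < i" "0 < j" "\<bar>int i - int j\<bar> > 1"
  shows "qsym_op i (qsym_op j f) = qsym_op j (qsym_op i f)"
proof (rule linear_op_eq_particlesI [of "\<lambda>f. qsym_op i (qsym_op j f)" "\<lambda>f. qsym_op j (qsym_op i f)"])
  have "transpose i (Suc i) j = j" "transpose i (Suc i) (Suc j) = Suc j"
    "transpose j (Suc j) i = i" "transpose j (Suc j) (Suc i) = Suc i"
    using assms(3) by (auto simp: transpose_def)
  then show "qsym_op i (qsym_op j (particle u)) = (qsym_op j (qsym_op i (particle u)) :: _ \<Rightarrow>\<^sub>0 'a)" for u
    using assms by (simp add: qsym_op_particle qsym_op_0 qsym_op_add swap_commute [of i j])
qed (rule linear_op_qsym_ops)+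

text \<open>Only the pattern of occurrences of the three letters in \<open>u\<close> matters. Both sides fix the particle
  if none or all of them occur, add up the three particles reached by raising if exactly \<open>i\<close>, or
  exactly \<open>i\<close> and \<open>Suc i\<close>, occur, and vanish in the other four cases.\<close>

lemma qsym_op_braid:
  assumes "0 < i"
  shows "qsym_op i (qsym_op (Suc i) (qsym_op i f)) = qsym_op (Suc i) (qsym_op i (qsym_op (Suc i) f))"
proof (rule linear_op_eq_particlesI [of "\<lambda>f. qsym_op i (qsym_op (Suc i) (qsym_op i f))"
      "\<lambda>f. qsym_op (Suc i) (qsym_op i (qsym_op (Suc i) f))"])
  fix u
  have t: "transpose i (Suc i) (Suc (Suc i)) = Suc (Suc i)"
    "transpose (Suc i) (Suc (Suc i)) i = i"
    by (auto simp: transpose_def)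
  show "qsym_op i (qsym_op (Suc i) (qsym_op i (particle u))) =
      (qsym_op (Suc i) (qsym_op i (qsym_op (Suc i) (particle u))) :: _ \<Rightarrow>\<^sub>0 'a)"
    using assms
    by (cases "i \<in> set u"; cases "Suc i \<in> set u"; cases "Suc (Suc i) \<in> set u")
      (simp_all add: t qsym_op_particle qsym_op_0 qsym_op_add)
qed (rule linear_op_qsym_ops)+

lemma free_act_hecke_relations:
  assumes "p \<in> hecke_relations n"
  shows "free_act p f = 0"
proof -
  interpret L: linear_op "\<lambda>p. free_act p f" by (rule linear_op_free_act_left)
  show ?thesis
    using assms unfolding hecke_relations_def
    by (auto simp: L.diff free_act_word qsym_op_idem qsym_op_commute qsym_op_braid)
qed

section \<open>Order ideals of words\<close>

definition same_order :: "nat list \<Rightarrow> nat list \<Rightarrow> bool" where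
  "same_order u t \<longleftrightarrow> length u = length t \<and>
     (\<forall>p<length t. \<forall>q<length t. u ! p < u ! q \<longleftrightarrow> t ! p < t ! q)"

lemma same_order_refl: "same_order u u"
  by (simp add: same_order_def)

lemma same_order_sym: "same_order u t \<Longrightarrow> same_order t u"
  by (simp add: same_order_def)

lemma same_order_trans: "same_order u t \<Longrightarrow> same_order t s \<Longrightarrow> same_order u s"
  by (simp add: same_order_def)

lemma same_order_less:
  assumes "same_order u t" "p < length t" "q < length t"
  shows "u ! p < u ! q \<longleftrightarrow> t ! p < t ! q"
  using assms by (simp add: same_order_def)

lemma same_order_eq:
  assumes "same_order u t" "p < length t" "q < length t"
  shows "u ! p = u ! q \<longleftrightarrow> t ! p = t ! q"
  using same_order_less [OF assms] same_order_less [OF assms(1,3,2)] by (metis less_irrefl linorder_neqE_nat)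

lemma same_order_swap:
  assumes "\<not> (i \<in> set u \<and> Suc i \<in> set u)"
  shows "same_order (swap i u) u"
  unfolding same_order_def
proof (intro conjI allI impI)
  fix p q
  assume pq: "p < length u" "q < length u"
  then have "\<not> (u ! p = i \<and> u ! q = Suc i)" "\<not> (u ! p = Suc i \<and> u ! q = i)"
    using assms nth_mem by metis+
  then show "swap i u ! p < swap i u ! q \<longleftrightarrow> u ! p < u ! q"
    using pq by (auto simp: transpose_def)
qed simp

text \<open>Words with positive letters ordered like \<open>t\<close> correspond to their sets of letters, all of the same
  size, and the pointwise
  order of the words is the Bruhat (Gale) order of these subsets.\<close>

definition order_ideal :: "nat list \<Rightarrow> nat list set" where
  "order_ideal t = {u. same_order u t \<and> (\<forall>p<length t. 0 < u ! p \<and> u ! p \<le> t ! p)}"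

lemma finite_order_ideal: "finite (order_ideal t)"
proof (rule finite_subset)
  show "order_ideal t \<subseteq> {u. set u \<subseteq> {..Max (set t)} \<and> length u = length t}"
    unfolding order_ideal_def same_order_def
    by (auto simp: in_set_conv_nth) (meson List.finite_set Max_ge le_trans nth_mem)
  show "finite {u. set u \<subseteq> {..Max (set t)} \<and> length u = length t}"
    by (rule finite_lists_length_eq) simp
qed

definition raise_step :: "nat \<Rightarrow> nat list \<Rightarrow> nat list" where
  "raise_step i t = (if i \<in> set t \<and> Suc i \<notin> set t then swap i t else t)"

lemma same_order_raise_step: "same_order (raise_step i t) t"
  by (simp add: raise_step_def same_order_refl same_order_swap)

lemma swap_le:
  assumes "p < length u" "i \<notin> set u"
  shows "swap i u ! p \<le> u ! p"
proof -
  have "u ! p \<noteq> i" using assms by (metis nth_mem)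
  then show ?thesis using assms(1) by (auto simp: transpose_def)
qed

lemma swap_ge:
  assumes "p < length u" "Suc i \<notin> set u"
  shows "u ! p \<le> swap i u ! p"
proof -
  have "u ! p \<noteq> Suc i" using assms by (metis nth_mem)
  then show ?thesis using assms(1) by (auto simp: transpose_def)
qed

lemma swap_down_in_order_ideal:
  assumes "0 < i" "u \<in> order_ideal t" "i \<notin> set u"
  shows "swap i u \<in> order_ideal t"
proof -
  have u: "same_order u t" "length u = length t" "\<And>p. p < length t \<Longrightarrow> 0 < u ! p \<and> u ! p \<le> t ! p"
    using assms(2) by (auto simp: order_ideal_def same_order_def)
  have "same_order (swap i u) t"
    using same_order_swap [of i u] u(1) assms(3) by (blast intro: same_order_trans)
  moreover have "0 < swap i u ! p \<and> swap i u ! p \<le> t ! p" if "p < length t" for p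
    using u(3) [OF that] swap_le [of p u i] that u(2) assms(1,3)
    by (auto simp: transpose_def)
  ultimately show ?thesis by (simp add: order_ideal_def)
qed

lemma order_ideal_raise_step_subset:
  "order_ideal t \<subseteq> order_ideal (raise_step i t)"
proof
  fix u assume u: "u \<in> order_ideal t"
  have "t ! p \<le> raise_step i t ! p" if "p < length t" for p
    using swap_ge [OF that] by (auto simp: raise_step_def)
  then show "u \<in> order_ideal (raise_step i t)"
    using u same_order_trans [OF _ same_order_sym [OF same_order_raise_step], of u t i]
      same_order_raise_step [of i t]
    unfolding order_ideal_def by (auto simp: same_order_def intro: le_trans)
qed

lemma swap_up_in_order_ideal:
  assumes "0 < i" "u \<in> order_ideal t" "i \<in> set u" "Suc i \<notin> set u"
  shows "swap i u \<in> order_ideal (raise_step i t)"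
proof -
  have u: "same_order u t" "length u = length t" "\<And>p. p < length t \<Longrightarrow> 0 < u ! p \<and> u ! p \<le> t ! p"
    using assms(2) by (auto simp: order_ideal_def same_order_def)
  have "same_order (swap i u) (raise_step i t)"
    using same_order_swap [of i u] u(1) assms(4) same_order_raise_step
    by (blast intro: same_order_trans same_order_sym)
  moreover have "0 < swap i u ! p \<and> swap i u ! p \<le> raise_step i t ! p" if p: "p < length t" for p
  proof -
    have ne: "u ! p \<noteq> Suc i" using assms(4) p u(2) by (metis nth_mem)
    have "Suc i \<le> raise_step i t ! p" if "u ! p = i"
    proof (cases "t ! p = i")
      case True
      \<comment> \<open>A letter \<open>Suc i\<close> of \<open>t\<close> would force the same letter in \<open>u\<close>: there \<open>u\<close> exceeds \<open>i\<close> and is at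
        most \<open>Suc i\<close>.\<close>
      have "Suc i \<notin> set t"
      proof
        assume "Suc i \<in> set t"
        then obtain q where q: "q < length t" "t ! q = Suc i"
          by (auto simp: in_set_conv_nth)
        then have "u ! p < u ! q" using same_order_less [OF u(1) p q(1)] True by simp
        then have "u ! q = Suc i" using u(3) [OF q(1)] q \<open>u ! p = i\<close> by simp
        then show False using assms(4) q(1) u(2) by (metis nth_mem)
      qed
      moreover have "i \<in> set t" using True p by (metis nth_mem)
      ultimately show ?thesis using True p by (simp add: raise_step_def)
    next
      case False
      then have "Suc i \<le> t ! p" using u(3) [OF p] that by simp
      then show ?thesis using swap_ge [OF p, of i] by (auto simp: raise_step_def)
    qed
    moreover have "u ! p \<le> raise_step i t ! p"
      using u(3) [OF p] swap_ge [OF p, of i] by (auto simp: raise_step_def)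
    ultimately show ?thesis
      using ne u(3) [OF p] p u(2) by (auto simp: transpose_def)
  qed
  moreover have "length (raise_step i t) = length t"
    by (simp add: raise_step_def)
  ultimately show ?thesis
    by (simp add: order_ideal_def del: nth_swap)
qed

text \<open>A word that is new in the larger ideal exceeds \<open>t\<close> at an occurrence of \<open>i\<close>, hence on the whole
  block of that letter; lowering this block brings it back below \<open>t\<close>.\<close>

lemma order_ideal_raise_stepD:
  assumes "0 < i" "u \<in> order_ideal (raise_step i t)" "u \<notin> order_ideal t"
  shows "Suc i \<in> set u" "i \<notin> set u" "swap i u \<in> order_ideal t"
proof -
  have t: "i \<in> set t" "Suc i \<notin> set t" and step: "raise_step i t = swap i t"
    using assms(2,3) by (auto simp: raise_step_def split: if_splits)
  have u: "same_order u t" "length u = length t" "\<And>p. p < length t \<Longrightarrow> 0 < u ! p \<and> u ! p \<le> swap i t ! p"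
    using assms(2) same_order_raise_step [of i t] step
    by (auto simp: order_ideal_def intro: same_order_trans) (auto simp: same_order_def)
  obtain p where p: "p < length t" "\<not> u ! p \<le> t ! p"
    using assms(3) u by (auto simp: order_ideal_def)
  have tp: "t ! p = i" "u ! p = Suc i"
    using u(3) [OF p(1)] p t nth_mem [OF p(1)] by (auto simp: transpose_def split: if_splits)
  then show "Suc i \<in> set u" using p(1) u(2) by (metis nth_mem)
  show i: "i \<notin> set u"
  proof
    assume "i \<in> set u"
    then obtain q where q: "q < length t" "u ! q = i" using u(2) by (auto simp: in_set_conv_nth)
    then have "t ! q < i" using same_order_less [OF u(1) q(1) p(1)] tp by simp
    then show False using u(3) [OF q(1)] q by (auto simp: transpose_def)
  qed
  have "swap i u ! q \<le> t ! q" if q: "q < length t" for q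
  proof (cases "t ! q = i")
    case True
    then have "u ! q = Suc i" using same_order_eq [OF u(1) q p(1)] tp by simp
    then show ?thesis using True q u(2) by simp
  next
    case False
    moreover have "t ! q \<noteq> Suc i" using t(2) q by (metis nth_mem)
    ultimately have "u ! q \<le> t ! q" using u(3) [OF q] q by simp
    then show ?thesis using swap_le [of q u i] q u(2) i by simp
  qed
  moreover have "0 < swap i u ! q" if "q < length t" for q
    using u(3) [OF that] that u(2) assms(1) by (auto simp: transpose_def)
  moreover have "same_order (swap i u) t"
    using same_order_swap [of i u] u(1) i by (blast intro: same_order_trans)
  ultimately show "swap i u \<in> order_ideal t" by (simp add: order_ideal_def)
qed

text \<open>Split the ideal according to which of \<open>i\<close> and \<open>Suc i\<close> occur. The words with \<open>Suc i\<close> alone contribute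
  zero, but they reappear as images under \<open>swap\<close> of words with \<open>i\<close> alone, since an order ideal
  is closed under lowering.\<close>

lemma qsym_op_order_ideal:
  assumes "0 < i"
  shows "qsym_op i (\<Sum>u\<in>order_ideal t. particle u) =
    (\<Sum>u\<in>order_ideal (raise_step i t). particle u :: nat list \<Rightarrow>\<^sub>0 'k::field_char_0)"
proof -
  interpret linear_op "qsym_op i :: (nat list \<Rightarrow>\<^sub>0 'k) \<Rightarrow> _" by (rule linear_op_qsym_op)
  let ?F = "{u \<in> order_ideal t. i \<in> set u \<longleftrightarrow> Suc i \<in> set u}"
    and ?A = "{u \<in> order_ideal t. i \<in> set u \<and> Suc i \<notin> set u}"
    and ?B = "{u \<in> order_ideal t. i \<notin> set u \<and> Suc i \<in> set u}"
  let ?L = "particle :: nat list \<Rightarrow> nat list \<Rightarrow>\<^sub>0 'k"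
  have fin: "finite ?F" "finite ?A" "finite ?B" by (simp_all add: finite_order_ideal)
  have "(\<Sum>u\<in>order_ideal t. qsym_op i (?L u)) = (\<Sum>u\<in>?F \<union> ?A \<union> ?B. qsym_op i (?L u))"
    by (rule sum.cong) auto
  also have "\<dots> = (\<Sum>u\<in>?F. qsym_op i (?L u)) + (\<Sum>u\<in>?A. qsym_op i (?L u)) +
      (\<Sum>u\<in>?B. qsym_op i (?L u))"
    by (subst sum.union_disjoint, use fin in \<open>auto\<close>)+
  also have "(\<Sum>u\<in>?F. qsym_op i (?L u)) = sum ?L ?F"
    by (rule sum.cong) (use assms in \<open>auto simp: qsym_op_particle\<close>)
  also have "(\<Sum>u\<in>?B. qsym_op i (?L u)) = 0"
    by (rule sum.neutral) (use assms in \<open>auto simp: qsym_op_particle\<close>)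
  also have "(\<Sum>u\<in>?A. qsym_op i (?L u)) = (\<Sum>u\<in>?A. ?L u + ?L (swap i u))"
    by (rule sum.cong) (use assms in \<open>auto simp: qsym_op_particle\<close>)
  also have "\<dots> = sum ?L ?A + sum ?L (swap i ` ?A)"
  proof -
    have "inj_on (swap i) ?A" by (rule inj_on_inverseI [of _ "swap i"]) simp
    then show ?thesis by (simp add: sum.distrib sum.reindex)
  qed
  also have "sum ?L ?F + (sum ?L ?A + sum ?L (swap i ` ?A)) + 0 = sum ?L (?F \<union> (?A \<union> swap i ` ?A))"
  proof -
    have "?A \<inter> swap i ` ?A = {}" "?F \<inter> (?A \<union> swap i ` ?A) = {}" by auto
    with fin show ?thesis by (simp add: sum.union_disjoint)
  qed
  also have "?F \<union> (?A \<union> swap i ` ?A) = order_ideal (raise_step i t)"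
  proof (intro equalityI subsetI)
    fix u assume "u \<in> ?F \<union> (?A \<union> swap i ` ?A)"
    then show "u \<in> order_ideal (raise_step i t)"
      using order_ideal_raise_step_subset [of t i] swap_up_in_order_ideal [OF assms] by auto
  next
    fix u assume u: "u \<in> order_ideal (raise_step i t)"
    have "u \<in> swap i ` ?A" if "Suc i \<in> set u" "i \<notin> set u" "swap i u \<in> order_ideal t"
      using that by (intro image_eqI [of _ _ "swap i u"]) auto
    then show "u \<in> ?F \<union> (?A \<union> swap i ` ?A)"
      using order_ideal_raise_stepD [OF assms u] swap_down_in_order_ideal [OF assms, of u t] by blast
  qed
  finally show ?thesis by (simp only: sum)
qed

lemma foldr_qsym_op_order_ideal:
  assumes "0 \<notin> set r"
  shows "foldr qsym_op r (\<Sum>u\<in>order_ideal t. particle u) =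
    (\<Sum>u\<in>order_ideal (foldr raise_step r t). particle u)"
  using assms by (induction r) (auto simp: qsym_op_order_ideal)

lemma same_order_foldr_raise_step: "same_order (foldr raise_step r t) t"
  by (induction r) (auto intro: same_order_refl same_order_trans same_order_raise_step)

section \<open>Reduced words\<close>

lemma perm_of_word_append: "perm_of_word (r @ s) = perm_of_word r \<circ> perm_of_word s"
  by (induction r) (auto simp: perm_of_word_def fun_eq_iff)

lemma perm_of_word_Cons: "perm_of_word (i # r) = transpose i (Suc i) \<circ> perm_of_word r"
  by (simp add: perm_of_word_def)

lemma perm_of_word_Nil: "perm_of_word [] = id"
  by (simp add: perm_of_word_def)

lemma bij_perm_of_word: "bij (perm_of_word r)"
proof (induction r)
  case Nil
  show ?case unfolding perm_of_word_Nil by (rule bij_id)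
next
  case (Cons i r)
  then show ?case unfolding perm_of_word_Cons by (rule bij_comp) (rule bij_transpose)
qed

lemma perm_of_word_0: "0 \<notin> set r \<Longrightarrow> perm_of_word r 0 = 0"
  by (induction r) (auto simp: perm_of_word_Nil perm_of_word_Cons transpose_def)

text \<open>The exchange condition. The hypothesis says that \<open>i\<close> and \<open>Suc i\<close> are inverted by the inverse
  permutation. Some letter of \<open>r\<close> creates this inversion, and multiplying by the transposition
  deletes that letter.\<close>

lemma perm_of_word_exchange:
  assumes "perm_of_word r x = i" "perm_of_word r y = Suc i" "y < x"
  shows "\<exists>r'. length r' < length r \<and> set r' \<subseteq> set r \<and>
    perm_of_word r' = transpose i (Suc i) \<circ> perm_of_word r"
  using assms
proof (induction r arbitrary: x y rule: rev_induct)
  case Nil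
  then show ?case by (simp add: perm_of_word_Nil)
next
  case (snoc j r)
  let ?g = "perm_of_word r"
  have g: "perm_of_word (r @ [j]) = ?g \<circ> transpose j (Suc j)"
    by (simp add: perm_of_word_append perm_of_word_Cons perm_of_word_Nil)
  let ?x = "transpose j (Suc j) x" and ?y = "transpose j (Suc j) y"
  have xy: "?g ?x = i" "?g ?y = Suc i" using snoc.prems g by simp_all
  show ?case
  proof (cases "?y < ?x")
    case True
    then obtain r' where "length r' < length r" "set r' \<subseteq> set r"
      "perm_of_word r' = transpose i (Suc i) \<circ> ?g"
      using snoc.IH [OF xy] by blast
    then show ?thesis
      by (intro exI [of _ "r' @ [j]"])
        (auto simp: perm_of_word_append perm_of_word_Cons perm_of_word_Nil comp_assoc)
  next
    case False
    then have "x = Suc j" "y = j" using snoc.prems(3) by (auto simp: transpose_def split: if_splits)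
    with xy have gj: "?g j = i" "?g (Suc j) = Suc i" by simp_all
    have "transpose i (Suc i) \<circ> (?g \<circ> transpose j (Suc j)) = ?g"
    proof
      fix z
      consider "z = j" | "z = Suc j" | "z \<noteq> j" "z \<noteq> Suc j" by blast
      then show "(transpose i (Suc i) \<circ> (?g \<circ> transpose j (Suc j))) z = ?g z"
      proof cases
        case 3
        then have "?g z \<noteq> i" "?g z \<noteq> Suc i"
          using gj inj_eq [OF bij_is_inj [OF bij_perm_of_word], of r z] by metis+
        with 3 show ?thesis by (simp add: transpose_apply_other)
      qed (simp_all add: gj)
    qed
    from this [symmetric] have "perm_of_word r = transpose i (Suc i) \<circ> perm_of_word (r @ [j])"
      unfolding g .
    then show ?thesis
      by (intro exI [of _ r] conjI) auto
  qed
qed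

lemma reduced_word_Cons:
  assumes "reduced_word n (perm_of_word (i # r)) (i # r)"
  shows "reduced_word n (perm_of_word r) r"
  unfolding reduced_word_def
proof (intro conjI ballI impI)
  show "r \<in> lists {1..<n}" using assms by (simp add: reduced_word_def)
  fix r' assume r': "r' \<in> lists {1..<n}" "perm_of_word r' = perm_of_word r"
  then have "perm_of_word (i # r') = perm_of_word (i # r)" "i # r' \<in> lists {1..<n}"
    using assms by (simp_all add: perm_of_word_Cons reduced_word_def)
  then have "length (i # r) \<le> length (i # r')"
    using assms unfolding reduced_word_def by blast
  then show "length r \<le> length r'" by simp
qed simp

text \<open>The step \<open>raise_step i\<close> differs from applying the transposition to the set of letters only if
  \<open>Suc i\<close> is a letter and \<open>i\<close> is not. As the initial set of letters is closed downwards, the two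
  letters would then be inverted, and the exchange condition would give a shorter word.\<close>

lemma set_foldr_raise_step:
  assumes "reduced_word n (perm_of_word r) r"
    and closed: "\<And>x y. x \<in> set t \<Longrightarrow> 0 < y \<Longrightarrow> y < x \<Longrightarrow> y \<in> set t"
  shows "set (foldr raise_step r t) = perm_of_word r ` set t"
  using assms(1)
proof (induction r)
  case Nil
  then show ?case by (simp add: perm_of_word_Nil)
next
  case (Cons i r)
  let ?g = "perm_of_word r" and ?t = "foldr raise_step r t"
  have IH: "set ?t = ?g ` set t"
    using Cons.IH reduced_word_Cons [OF Cons.prems] by blast
  have r: "i # r \<in> lists {1..<n}" using Cons.prems by (simp add: reduced_word_def)
  have img: "perm_of_word (i # r) ` set t = transpose i (Suc i) ` set ?t"
    by (simp add: perm_of_word_Cons IH image_comp)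
  have swap: "set (swap i ?t) = transpose i (Suc i) ` set ?t"
    by (simp add: swap_def)
  have up: "i \<in> set ?t" if Suc: "Suc i \<in> set ?t"
  proof -
    obtain y where y: "y \<in> set t" "?g y = Suc i" using Suc IH by auto
    obtain x where x: "?g x = i" using bij_perm_of_word [of r] by (metis bij_pointE)
    have "x \<noteq> y" using x y by auto
    moreover have "\<not> y < x"
    proof
      assume "y < x"
      then obtain r' where r': "length r' < length r" "set r' \<subseteq> set r"
        "perm_of_word r' = perm_of_word (i # r)"
        using perm_of_word_exchange [OF x y(2)] by (auto simp: perm_of_word_Cons)
      then have "r' \<in> lists {1..<n}" using r by auto
      then have "length (i # r) \<le> length r'"
        using Cons.prems r'(3) unfolding reduced_word_def by blast
      with r'(1) show False by simp
    qed
    moreover have "0 < x"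
    proof (rule ccontr)
      assume "\<not> 0 < x"
      moreover have "0 \<notin> set r" "0 < i" using r by auto
      ultimately show False using x perm_of_word_0 by simp
    qed
    ultimately have "x \<in> set t" using closed [OF y(1), of x] by simp
    then show ?thesis using x IH by auto
  qed
  show ?case
  proof (cases "Suc i \<in> set ?t \<longleftrightarrow> i \<in> set ?t")
    case True
    then have "transpose i (Suc i) ` set ?t = set ?t"
      by (simp add: transpose_image_eq)
    then show ?thesis using True by (simp add: img raise_step_def [of i ?t])
  next
    case False
    then show ?thesis using up by (auto simp: img raise_step_def [of i ?t] swap)
  qed
qed

section \<open>The longest element\<close>

text \<open>Just below each positive letter of \<open>u\<close> there is another letter of \<open>u\<close> or zero, which leaves no room
  for lowering.\<close>

lemma particle_packed:
  assumes "\<And>x y. x \<in> set u \<Longrightarrow> 0 < y \<Longrightarrow> y < x \<Longrightarrow> y \<in> set u"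
  shows "particle u = word u"
proof -
  have "v = u" if v: "v \<in> particle_words u" for v
  proof (rule nth_equalityI)
    show "length v = length u" by (rule particle_wordsD(1) [OF v])
    fix p assume "p < length v"
    then have p: "p < length u" by (simp add: particle_wordsD(1) [OF v])
    have "u ! p \<le> v ! p"
    proof (cases "u ! p \<le> 1")
      case True
      then show ?thesis using particle_wordsD(3) [OF v p] by linarith
    next
      case False
      then have "u ! p - 1 \<in> set u" using assms [of "u ! p" "u ! p - 1"] p by simp
      then obtain q where "q < length u" "u ! q = u ! p - 1" by (auto simp: in_set_conv_nth)
      then show ?thesis using particle_wordsD(4) [OF v p, of q] False by simp
    qed
    then show "v ! p = u ! p" using particle_wordsD(2) [OF v p] by simp
  qed
  then have "particle_words u = {u}" using self_in_particle_words by auto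
  then show ?thesis by (simp add: particle_def)
qed

text \<open>By induction on the letters: a word ordered like \<open>u\<close> with positive letters lies above \<open>u\<close>.\<close>

lemma order_ideal_packed:
  assumes "0 \<notin> set u" and closed: "\<And>x y. x \<in> set u \<Longrightarrow> 0 < y \<Longrightarrow> y < x \<Longrightarrow> y \<in> set u"
  shows "order_ideal u = {u}"
proof -
  have "v = u" if v: "v \<in> order_ideal u" for v
  proof (rule nth_equalityI)
    have so: "same_order v u" and len: "length v = length u"
      and b: "\<And>p. p < length u \<Longrightarrow> 0 < v ! p \<and> v ! p \<le> u ! p"
      using v by (auto simp: order_ideal_def same_order_def)
    show "length v = length u" by (rule len)
    have "x \<le> v ! p" if "p < length u" "u ! p = x" for p x
      using that
    proof (induction x arbitrary: p)
      case (Suc x)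
      show ?case
      proof (cases "x = 0")
        case True
        then show ?thesis using b [OF Suc.prems(1)] by simp
      next
        case False
        then have "x \<in> set u" using closed [of "Suc x" x] Suc.prems nth_mem by fastforce
        then obtain q where q: "q < length u" "u ! q = x" by (auto simp: in_set_conv_nth)
        then have "x \<le> v ! q" by (rule Suc.IH)
        also have "v ! q < v ! p" using same_order_less [OF so q(1) Suc.prems(1)] q Suc.prems by simp
        finally show ?thesis by simp
      qed
    qed simp
    then show "v ! p = u ! p" if "p < length v" for p
      using b [of p] that len by (simp add: le_antisym)
  qed
  moreover have "u \<in> order_ideal u"
    using assms(1) by (auto simp: order_ideal_def same_order_refl) (metis gr0I nth_mem)
  ultimately show ?thesis by auto
qed

text \<open>By induction downwards from \<open>n\<close>: the letters of \<open>u\<close> that exceed a given one need as much room below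
  \<open>n\<close> as those of \<open>t\<close>, and these fill it completely.\<close>

lemma order_ideal_top:
  assumes "set t \<subseteq> {1..n}" and closed: "\<And>x. x \<in> set t \<Longrightarrow> x < n \<Longrightarrow> Suc x \<in> set t"
  shows "order_ideal t = {u. same_order u t \<and> set u \<subseteq> {1..n}}"
proof (intro equalityI subsetI)
  fix u assume "u \<in> order_ideal t"
  then have so: "same_order u t" and b: "\<And>p. p < length t \<Longrightarrow> 0 < u ! p \<and> u ! p \<le> t ! p"
    by (auto simp: order_ideal_def)
  have "x \<in> {1..n}" if x: "x \<in> set u" for x
  proof -
    obtain p where p: "p < length t" "u ! p = x" using x so by (auto simp: in_set_conv_nth same_order_def)
    then have "t ! p \<le> n" using assms(1) p(1) by (metis atLeastAtMost_iff nth_mem subsetD)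
    then show ?thesis using b [OF p(1)] p(2) by simp
  qed
  with so show "u \<in> {u. same_order u t \<and> set u \<subseteq> {1..n}}" by auto
next
  fix u assume "u \<in> {u. same_order u t \<and> set u \<subseteq> {1..n}}"
  then have so: "same_order u t" and u: "set u \<subseteq> {1..n}" by auto
  have len: "length u = length t" using so by (simp add: same_order_def)
  have "u ! p + d \<le> n" if "p < length t" "t ! p + d = n" for p d
    using that
  proof (induction d arbitrary: p)
    case 0
    then have "u ! p \<in> {1..n}" using u len by (metis nth_mem subsetD)
    with 0 show ?case by simp
  next
    case (Suc d)
    then have "Suc (t ! p) \<in> set t" using closed [of "t ! p"] by simp
    then obtain q where q: "q < length t" "t ! q = Suc (t ! p)" by (auto simp: in_set_conv_nth)
    then have "u ! q + d \<le> n" using Suc by simp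
    moreover have "u ! p < u ! q" using same_order_less [OF so Suc.prems(1) q(1)] q by simp
    ultimately show ?case by simp
  qed
  then have "u ! p \<le> t ! p" if "p < length t" for p
  proof -
    have "t ! p \<le> n" using assms(1) that by (metis atLeastAtMost_iff nth_mem subsetD)
    with \<open>\<And>p d. \<lbrakk>p < length t; t ! p + d = n\<rbrakk> \<Longrightarrow> u ! p + d \<le> n\<close> [OF that, of "n - t ! p"]
    show ?thesis by simp
  qed
  moreover have "0 < u ! p" if "p < length t" for p
  proof -
    have "u ! p \<in> {1..n}" using u len that by (metis nth_mem subsetD)
    then show ?thesis by simp
  qed
  ultimately show "u \<in> order_ideal t" using so by (simp add: order_ideal_def)
qed

lemma foldr_qsym_op_longest:
  assumes r: "reduced_word n (longest_perm n) r" and u: "set u \<subseteq> {1..n}"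
    and closed: "\<And>x y. x \<in> set u \<Longrightarrow> 0 < y \<Longrightarrow> y < x \<Longrightarrow> y \<in> set u"
  shows "foldr qsym_op r (word u) =
    (\<Sum>v\<in>{v. same_order v u \<and> set v \<subseteq> {1..n}}. particle v :: nat list \<Rightarrow>\<^sub>0 'k::field_char_0)"
proof -
  let ?t = "foldr raise_step r u"
  have perm: "perm_of_word r = longest_perm n" and r0: "0 \<notin> set r"
    using r by (auto simp: reduced_word_def)
  have set_t: "set ?t = longest_perm n ` set u"
    using set_foldr_raise_step [of n r u] r closed perm by simp
  have "order_ideal ?t = {v. same_order v ?t \<and> set v \<subseteq> {1..n}}"
  proof (rule order_ideal_top)
    show "set ?t \<subseteq> {1..n}"
      unfolding set_t using u by (auto simp: longest_perm_def)
    fix x assume "x \<in> set ?t" "x < n"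
    then obtain y where y: "y \<in> set u" "x = Suc n - y"
      using u by (auto simp: set_t longest_perm_def)
    have "y \<in> {1..n}" using y(1) u by auto
    with y(2) \<open>x < n\<close> have y': "1 < y" "y \<le> n" by auto
    then have "y - 1 \<in> set u" using closed [OF y(1), of "y - 1"] by simp
    moreover have "Suc x = longest_perm n (y - 1)"
      using y(2) y' by (auto simp: longest_perm_def)
    ultimately show "Suc x \<in> set ?t" unfolding set_t by blast
  qed
  also have "\<dots> = {v. same_order v u \<and> set v \<subseteq> {1..n}}"
    using same_order_foldr_raise_step [of r u] by (blast intro: same_order_trans same_order_sym)
  finally have ideal: "order_ideal ?t = {v. same_order v u \<and> set v \<subseteq> {1..n}}" .
  have "0 \<notin> set u" using u by auto
  then have "order_ideal u = {u}"
    using closed by (rule order_ideal_packed)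
  moreover have "particle u = (word u :: nat list \<Rightarrow>\<^sub>0 'k)"
    using closed by (rule particle_packed)
  ultimately have "word u = (\<Sum>v\<in>order_ideal u. particle v :: nat list \<Rightarrow>\<^sub>0 'k)"
    by simp
  then show ?thesis
    using foldr_qsym_op_order_ideal [OF r0, of u] ideal by simp
qed

section \<open>Words with a given standardization\<close>

text \<open>The labels of \<open>std\<close> are ranks for a total order of the positions, and a permutation of \<open>{1..n}\<close>
  is the list of ranks of the order that it defines.\<close>

lemma std_eq_iff:
  fixes w :: "'a::linorder list"
  assumes "\<tau> permutes {1..n}"
  shows "std w = one_line n \<tau> \<longleftrightarrow> length w = n \<and>
    (\<forall>p<n. \<forall>q<n. \<tau> (Suc p) < \<tau> (Suc q) \<longleftrightarrow> w ! p < w ! q \<or> w ! p = w ! q \<and> p < q)"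
    (is "_ \<longleftrightarrow> _ \<and> ?ord")
proof -
  let ?before = "\<lambda>q p. w ! q < w ! p \<or> w ! q = w ! p \<and> q < p"
  let ?S = "\<lambda>p. {q. q < n \<and> ?before q p}"
  have \<tau>: "\<tau> (Suc p) \<in> {1..n}" if "p < n" for p
    using permutes_in_image [OF assms, of "Suc p"] that by simp
  have nth: "std w = one_line n \<tau> \<longleftrightarrow> length w = n \<and> (\<forall>p<n. Suc (card (?S p)) = \<tau> (Suc p))"
  proof (cases "length w = n")
    case True
    have "std w ! p = Suc (card (?S p))" "one_line n \<tau> ! p = \<tau> (Suc p)" if "p < n" for p
      using that True by (simp_all add: std_def one_line_def del: upt_Suc)
    moreover have "length (std w) = n" "length (one_line n \<tau>) = n"
      by (simp_all add: std_def one_line_def True)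
    ultimately show ?thesis
      using True by (simp only: list_eq_iff_nth_eq simp_thms cong: imp_cong)
  next
    case False
    then have "length (std w) \<noteq> length (one_line n \<tau>)"
      by (simp add: std_def one_line_def del: upt_Suc)
    with False show ?thesis by auto
  qed
  have fin: "finite (?S p)" for p by simp
  have "(\<forall>p<n. Suc (card (?S p)) = \<tau> (Suc p)) \<longleftrightarrow> ?ord"
  proof
    assume card: "\<forall>p<n. Suc (card (?S p)) = \<tau> (Suc p)"
    have mono: "\<tau> (Suc p) < \<tau> (Suc q)" if "p < n" "q < n" "?before p q" for p q
    proof -
      have "?S p \<subset> ?S q" using that by fastforce
      then have "card (?S p) < card (?S q)" by (rule psubset_card_mono [OF fin])
      moreover have "Suc (card (?S p)) = \<tau> (Suc p)" "Suc (card (?S q)) = \<tau> (Suc q)"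
        using card that(1,2) by blast+
      ultimately show ?thesis by linarith
    qed
    show ?ord
    proof (intro allI impI iffI)
      fix p q assume "p < n" "q < n" "\<tau> (Suc p) < \<tau> (Suc q)"
      moreover have "p = q \<or> ?before p q \<or> ?before q p" by (metis linorder_neqE)
      ultimately show "?before p q" using mono [of q p] by (metis less_asym less_irrefl)
    qed (use mono in blast)
  next
    assume ord: ?ord
    show "\<forall>p<n. Suc (card (?S p)) = \<tau> (Suc p)"
    proof (intro allI impI)
      fix p assume p: "p < n"
      have "bij_betw (\<lambda>q. \<tau> (Suc q)) (?S p) {1..<\<tau> (Suc p)}"
      proof (rule bij_betw_imageI)
        show "inj_on (\<lambda>q. \<tau> (Suc q)) (?S p)"
          using permutes_inj [OF assms] by (auto simp: inj_on_def dest: injD)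
        show "(\<lambda>q. \<tau> (Suc q)) ` ?S p = {1..<\<tau> (Suc p)}"
        proof (intro equalityI subsetI)
          fix x assume "x \<in> (\<lambda>q. \<tau> (Suc q)) ` ?S p"
          then obtain q where "q < n" "?before q p" "x = \<tau> (Suc q)" by auto
          then show "x \<in> {1..<\<tau> (Suc p)}" using ord p \<tau> [of q] by auto
        next
          fix x assume x: "x \<in> {1..<\<tau> (Suc p)}"
          then have "x \<in> \<tau> ` {1..n}" using \<tau> [OF p] permutes_image [OF assms] by auto
          then obtain m where m: "m \<in> {1..n}" "x = \<tau> m" by blast
          define q where "q = m - 1"
          have q: "q < n" "x = \<tau> (Suc q)" using m by (auto simp: q_def)
          then have "?before q p" using ord p x by auto
          then show "x \<in> (\<lambda>q. \<tau> (Suc q)) ` ?S p" using q by blast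
        qed
      qed
      then have "card (?S p) = card {1..<\<tau> (Suc p)}" by (rule bij_betw_same_card)
      then show "Suc (card (?S p)) = \<tau> (Suc p)" using \<tau> [OF p] by simp
    qed
  qed
  then show ?thesis using nth by simp
qed

lemma lexorder_le_of_nth_le:
  fixes u v :: "'a::linorder list"
  assumes "length u = length v" "\<And>p. p < length u \<Longrightarrow> u ! p \<le> v ! p"
  shows "u \<le> v"
  using assms
proof (induction u v rule: list_induct2)
  case (Cons x u y v)
  have "x \<le> y" using Cons.prems [of 0] by simp
  moreover have "u \<le> v" using Cons.prems [of "Suc p" for p] by (intro Cons.IH) auto
  ultimately show ?case by auto
qed simp

context
  fixes n :: nat and \<sigma> :: "nat \<Rightarrow> nat"
  assumes \<sigma>: "\<sigma> permutes {1..n}"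
begin

definition descents_before :: "nat \<Rightarrow> nat" where
  "descents_before e = card {d \<in> {1..<e}. \<sigma> (Suc d) < \<sigma> d}"

text \<open>The position with label \<open>e\<close> receives one more than the number of descents of \<open>\<sigma>\<close> before \<open>e\<close>: going
  through the positions in the order of their labels, the letter increases only when the next
  position lies to the left, where an increase is unavoidable.\<close>

definition packed_word :: "nat list" where
  "packed_word = map (\<lambda>p. Suc (descents_before (inv_into UNIV \<sigma> (Suc p)))) [0..<n]"

lemma descents_before_1: "descents_before (Suc 0) = 0"
  by (simp add: descents_before_def)

lemma descents_before_Suc:
  assumes "0 < e"
  shows "descents_before (Suc e) = descents_before e + (if \<sigma> (Suc e) < \<sigma> e then 1 else 0)"
proof -
  have "{d \<in> {1..<Suc e}. \<sigma> (Suc d) < \<sigma> d} =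
      (if \<sigma> (Suc e) < \<sigma> e then insert e else id) {d \<in> {1..<e}. \<sigma> (Suc d) < \<sigma> d}"
    using assms by (auto simp: less_Suc_eq)
  then show ?thesis by (simp add: descents_before_def)
qed

lemma inv_range: "p < n \<Longrightarrow> inv_into UNIV \<sigma> (Suc p) \<in> {1..n}"
  using permutes_in_image [OF permutes_inv [OF \<sigma>], of "Suc p"] by simp

lemma \<sigma>_inv: "\<sigma> (inv_into UNIV \<sigma> x) = x"
  by (rule permutes_inverses(1) [OF \<sigma>])

lemma inv_\<sigma>: "inv_into UNIV \<sigma> (\<sigma> x) = x"
  by (rule permutes_inverses(2) [OF \<sigma>])

lemma \<sigma>_range: "d \<in> {1..n} \<Longrightarrow> \<sigma> d \<in> {1..n}"
  using permutes_in_image [OF \<sigma>] by blast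

lemma std_class_iff:
  "v \<in> std_class {1..n} n \<sigma> \<longleftrightarrow> set v \<subseteq> {1..n} \<and> length v = n \<and>
    (\<forall>p<n. \<forall>q<n. inv_into UNIV \<sigma> (Suc p) < inv_into UNIV \<sigma> (Suc q) \<longleftrightarrow>
       v ! p < v ! q \<or> v ! p = v ! q \<and> p < q)"
  unfolding std_class_def using std_eq_iff [OF permutes_inv [OF \<sigma>], of v] by auto

lemma std_classD:
  assumes "v \<in> std_class {1..n} n \<sigma>"
  shows "length v = n" "set v \<subseteq> {1..n}" "p < n \<Longrightarrow> v ! p \<in> {1..n}"
proof -
  show v: "length v = n" "set v \<subseteq> {1..n}"
    using assms unfolding std_class_iff by blast+
  show "v ! p \<in> {1..n}" if "p < n"
    using v(2) nth_mem [of p v] that unfolding v(1) by blast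
qed

text \<open>The positions labelled \<open>d\<close> and \<open>Suc d\<close> are \<open>\<sigma> d\<close> and \<open>\<sigma> (Suc d)\<close>, counted from 1. From the first to the
  second the letter cannot decrease, and it increases if \<open>\<sigma>\<close> has a descent at \<open>d\<close>.\<close>

lemma std_class_growth:
  assumes v: "v \<in> std_class {1..n} n \<sigma>" and de: "0 < d" "d \<le> e" "e \<le> n"
  shows "v ! (\<sigma> d - 1) + descents_before e \<le> v ! (\<sigma> e - 1) + descents_before d"
  using de(2,3)
proof (induction e rule: dec_induct)
  case (step e)
  have e: "0 < e" "e < n" using step de(1) by auto
  then have "\<sigma> e \<in> {1..n}" "\<sigma> (Suc e) \<in> {1..n}" using \<sigma>_range by simp_all
  then have "\<sigma> e - 1 < n" "\<sigma> (Suc e) - 1 < n" "Suc (\<sigma> e - 1) = \<sigma> e" "Suc (\<sigma> (Suc e) - 1) = \<sigma> (Suc e)"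
    by auto
  then have "v ! (\<sigma> e - 1) < v ! (\<sigma> (Suc e) - 1) \<or>
      v ! (\<sigma> e - 1) = v ! (\<sigma> (Suc e) - 1) \<and> \<sigma> e - 1 < \<sigma> (Suc e) - 1"
    using v inv_\<sigma> unfolding std_class_iff by (metis lessI)
  then show ?case
    using step e by (auto simp: descents_before_Suc)
qed simp

lemma length_packed_word [simp]: "length packed_word = n"
  by (simp add: packed_word_def)

lemma nth_packed_word: "p < n \<Longrightarrow> packed_word ! p = Suc (descents_before (inv_into UNIV \<sigma> (Suc p)))"
  by (simp add: packed_word_def)

lemma descents_before_mono: "d \<le> e \<Longrightarrow> descents_before d \<le> descents_before e"
  unfolding descents_before_def by (rule card_mono) auto

lemma no_descent_increasing:
  assumes "0 < d" "Suc d \<le> e" "descents_before e = descents_before d"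
  shows "\<sigma> d < \<sigma> e"
  using assms(2,3)
proof (induction e rule: dec_induct)
  case base
  have "\<sigma> d \<noteq> \<sigma> (Suc d)" using permutes_inj [OF \<sigma>] by (metis injD n_not_Suc_n)
  then show ?case using base assms(1) by (auto simp: descents_before_Suc split: if_splits)
next
  case (step e)
  \<comment> \<open>The count lies between its equal values at \<open>d\<close> and \<open>Suc e\<close>.\<close>
  have "descents_before d \<le> descents_before e" "0 < e"
    using step.hyps by (auto intro: descents_before_mono)
  then have "descents_before e = descents_before d" "\<not> \<sigma> (Suc e) < \<sigma> e"
    using step.prems by (auto simp: descents_before_Suc split: if_splits)
  then show ?case using step.IH by simp
qed

lemma packed_word_in_class: "packed_word \<in> std_class {1..n} n \<sigma>"
  unfolding std_class_iff
proof (intro conjI allI impI)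
  show "set packed_word \<subseteq> {1..n}"
  proof
    fix x assume "x \<in> set packed_word"
    then obtain p where p: "p < n" "x = packed_word ! p" by (auto simp: in_set_conv_nth)
    have "descents_before e \<le> e - 1" for e
      unfolding descents_before_def
      by (rule order_trans [OF card_mono [of "{1..<e}"]]) auto
    from this [of "inv_into UNIV \<sigma> (Suc p)"] show "x \<in> {1..n}"
      using p inv_range [OF p(1)] by (auto simp: nth_packed_word)
  qed
  have less: "packed_word ! p < packed_word ! q \<or> packed_word ! p = packed_word ! q \<and> p < q"
    if pq: "p < n" "q < n" "inv_into UNIV \<sigma> (Suc p) < inv_into UNIV \<sigma> (Suc q)" for p q
  proof -
    let ?d = "inv_into UNIV \<sigma> (Suc p)" and ?e = "inv_into UNIV \<sigma> (Suc q)"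
    have "descents_before ?d \<le> descents_before ?e" using pq(3) by (simp add: descents_before_mono)
    moreover have "p < q" if "descents_before ?e = descents_before ?d"
      using no_descent_increasing [of ?d ?e] inv_range [OF pq(1)] pq(3) that by (simp add: \<sigma>_inv)
    ultimately show ?thesis using pq by (auto simp: nth_packed_word)
  qed
  fix p q assume pq: "p < n" "q < n"
  have "inv_into UNIV \<sigma> (Suc p) = inv_into UNIV \<sigma> (Suc q) \<longleftrightarrow> p = q"
    by (metis \<sigma>_inv nat.inject)
  then show "inv_into UNIV \<sigma> (Suc p) < inv_into UNIV \<sigma> (Suc q) \<longleftrightarrow>
      packed_word ! p < packed_word ! q \<or> packed_word ! p = packed_word ! q \<and> p < q"
    using less [OF pq] less [OF pq(2,1)] by (metis less_asym less_irrefl linorder_neqE_nat)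
qed simp

lemma packed_word_le:
  assumes v: "v \<in> std_class {1..n} n \<sigma>" and p: "p < n"
  shows "packed_word ! p \<le> v ! p"
proof -
  let ?e = "inv_into UNIV \<sigma> (Suc p)"
  have e: "1 \<le> ?e" "?e \<le> n" using inv_range [OF p] by auto
  have "1 \<in> {1..n}" using p by simp
  then have "\<sigma> 1 \<in> {1..n}" by (rule \<sigma>_range)
  then have "1 \<le> v ! (\<sigma> 1 - 1)" using std_classD(3) [OF v, of "\<sigma> 1 - 1"] by auto
  then show ?thesis
    using std_class_growth [OF v, of 1 ?e] e p
    by (simp add: \<sigma>_inv nth_packed_word descents_before_1)
qed

lemma finite_std_class: "finite (std_class {1..n} n \<sigma> :: nat list set)"
proof (rule finite_subset)
  show "std_class {1..n} n \<sigma> \<subseteq> {v. set v \<subseteq> {1..n} \<and> length v = n}"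
    using std_classD by blast
qed (simp add: finite_lists_length_eq)

text \<open>The packed word is minimal pointwise, hence also lexicographically.\<close>

lemma min_word_eq: "min_word {1..n} n \<sigma> = packed_word"
  unfolding min_word_def
proof (rule Min_eqI)
  fix v assume v: "v \<in> std_class {1..n} n \<sigma>"
  then show "packed_word \<le> v"
    by (intro lexorder_le_of_nth_le packed_word_le) (simp_all add: std_classD(1))
qed (rule finite_std_class packed_word_in_class)+

lemma packed_word_closed:
  assumes "x \<in> set packed_word" "0 < y" "y < x"
  shows "y \<in> set packed_word"
proof -
  have "\<exists>d\<in>{1..e}. Suc (descents_before d) = y" if "1 \<le> e" "y \<le> Suc (descents_before e)" for e
    using that
  proof (induction e rule: dec_induct)
    case base
    then show ?case using assms(2) by (auto simp: descents_before_1)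
  next
    case (step e)
    show ?case
    proof (cases "y \<le> Suc (descents_before e)")
      case True
      then show ?thesis using step.IH by force
    next
      case False
      then have "y = Suc (descents_before (Suc e))"
        using step by (auto simp: descents_before_Suc split: if_splits)
      then show ?thesis by auto
    qed
  qed
  moreover obtain p where p: "p < n" "x = Suc (descents_before (inv_into UNIV \<sigma> (Suc p)))"
    using assms(1) by (auto simp: packed_word_def)
  ultimately obtain d where d: "d \<in> {1..inv_into UNIV \<sigma> (Suc p)}" "y = Suc (descents_before d)"
    using assms(3) inv_range [OF p(1)] by (metis atLeastAtMost_iff less_imp_le)
  then have "d \<in> {1..n}" using inv_range [OF p(1)] by auto
  then have "\<sigma> d \<in> {1..n}" by (rule \<sigma>_range)
  then have "\<sigma> d - 1 < n" "packed_word ! (\<sigma> d - 1) = y"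
    using d(2) by (auto simp: nth_packed_word inv_\<sigma>)
  then show ?thesis by (metis length_packed_word nth_mem)
qed

text \<open>Different letters of the packed word are separated by a descent of \<open>\<sigma>\<close>, which every word of the
  class respects.\<close>

lemma std_class_block_less:
  assumes v: "v \<in> std_class {1..n} n \<sigma>" and pq: "p < n" "q < n" "packed_word ! p < packed_word ! q"
  shows "v ! p < v ! q"
proof -
  let ?d = "inv_into UNIV \<sigma> (Suc p)" and ?e = "inv_into UNIV \<sigma> (Suc q)"
  have less: "descents_before ?d < descents_before ?e" using pq by (simp add: nth_packed_word)
  then have "?d < ?e" using descents_before_mono by (meson linorder_not_le)
  then show ?thesis
    using std_class_growth [OF v, of ?d ?e] inv_range [OF pq(1)] inv_range [OF pq(2)] less
    by (simp add: \<sigma>_inv)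
qed

lemma std_class_block_le:
  assumes v: "v \<in> std_class {1..n} n \<sigma>" and pq: "p < q" "q < n" "packed_word ! p = packed_word ! q"
  shows "v ! p \<le> v ! q"
proof -
  have "inv_into UNIV \<sigma> (Suc p) < inv_into UNIV \<sigma> (Suc q)"
    using packed_word_in_class pq unfolding std_class_iff by (metis less_trans)
  then show ?thesis using v pq unfolding std_class_iff by (metis less_imp_le order_refl less_trans)
qed

section \<open>Partition of a standardization class into particles\<close>

lemma particle_word_in_std_class:
  assumes so: "same_order u packed_word" and u: "set u \<subseteq> {1..n}" and v: "v \<in> particle_words u"
  shows "v \<in> std_class {1..n} n \<sigma>"
proof -
  have len: "length u = n" "length v = n"
    using so particle_wordsD(1) [OF v] by (simp_all add: same_order_def)
  note D = particle_wordsD(2-5) [OF v, unfolded len]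
  have upos: "0 < u ! p \<and> u ! p \<le> n" if "p < n" for p
  proof -
    have "u ! p \<in> {1..n}" using u nth_mem [of p u] that unfolding len by blast
    then show ?thesis by simp
  qed
  have "set v \<subseteq> {1..n}"
  proof
    fix x assume "x \<in> set v"
    then obtain p where "p < n" "x = v ! p" using len by (auto simp: in_set_conv_nth)
    then show "x \<in> {1..n}" using D(1,2) [of p] upos [of p] by auto
  qed
  moreover have "inv_into UNIV \<sigma> (Suc p) < inv_into UNIV \<sigma> (Suc q) \<longleftrightarrow>
      v ! p < v ! q \<or> v ! p = v ! q \<and> p < q" if pq: "p < n" "q < n" for p q
  proof -
    have less: "v ! p < v ! q" if "p < n" "q < n" "packed_word ! p < packed_word ! q" for p q
    proof -
      have "u ! p < u ! q" using same_order_less [OF so] that by simp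
      then show ?thesis using D(1) [of p] D(3) [of q p] that by simp
    qed
    have le: "v ! p \<le> v ! q" if "p < q" "q < n" "packed_word ! p = packed_word ! q" for p q
      using D(4) [of p q] same_order_eq [OF so, of p q] that by simp
    have "inv_into UNIV \<sigma> (Suc p) < inv_into UNIV \<sigma> (Suc q) \<longleftrightarrow>
        packed_word ! p < packed_word ! q \<or> packed_word ! p = packed_word ! q \<and> p < q"
      using packed_word_in_class pq unfolding std_class_iff by blast
    then show ?thesis
      using less [OF pq] less [OF pq(2,1)] le [of p q] le [of q p] pq
      by (metis antisym_conv2 less_asym less_irrefl linorder_neqE_nat order_le_less)
  qed
  ultimately show ?thesis using len unfolding std_class_iff by blast
qed

text \<open>This recovers \<open>u\<close> from any word of its particle.\<close>

definition block_max :: "nat list \<Rightarrow> nat list" where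
  "block_max v = map (\<lambda>p. Max {v ! q |q. q < n \<and> packed_word ! q = packed_word ! p}) [0..<n]"

text \<open>In a word of the particle of \<open>u\<close>, the letters of a block lie below the letter of \<open>u\<close>, and one of them
  attains it.\<close>

lemma block_max_eqI:
  assumes so: "same_order u packed_word" and v: "v \<in> particle_words u"
  shows "u = block_max v"
proof (rule nth_equalityI)
  have len: "length u = n" "length v = n"
    using so particle_wordsD(1) [OF v] by (simp_all add: same_order_def)
  note D = particle_wordsD [OF v, unfolded len]
  show "length u = length (block_max v)" by (simp add: len block_max_def)
  fix p assume "p < length u"
  then have p: "p < n" by (simp add: len)
  have "Max {v ! q |q. q < n \<and> packed_word ! q = packed_word ! p} = u ! p"
  proof (rule Max_eqI)
    show "finite {v ! q |q. q < n \<and> packed_word ! q = packed_word ! p}" by simp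
    fix y assume "y \<in> {v ! q |q. q < n \<and> packed_word ! q = packed_word ! p}"
    then obtain q where q: "q < n" "packed_word ! q = packed_word ! p" "y = v ! q" by auto
    then have "u ! q = u ! p" using same_order_eq [OF so] p by simp
    then show "y \<le> u ! p" using D(2) [of q] q by simp
  next
    have "u ! p \<in> set v" using D(6) p len by auto
    then obtain q where q: "q < n" "v ! q = u ! p" by (auto simp: in_set_conv_nth len)
    have "\<not> u ! p < u ! q" using D(4) [OF q(1) p] q(2) by auto
    then have "u ! q = u ! p" using D(2) [OF q(1)] q(2) by simp
    then have "packed_word ! q = packed_word ! p" using same_order_eq [OF so] q(1) p by simp
    then show "u ! p \<in> {v ! q |q. q < n \<and> packed_word ! q = packed_word ! p}" using q by force
  qed
  then show "u ! p = block_max v ! p" using p by (simp add: block_max_def)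
qed

lemma block_max_properties:
  assumes v: "v \<in> std_class {1..n} n \<sigma>"
  shows "same_order (block_max v) packed_word" "set (block_max v) \<subseteq> {1..n}"
    "v \<in> particle_words (block_max v)"
proof -
  let ?B = "\<lambda>p. {v ! q |q. q < n \<and> packed_word ! q = packed_word ! p}" and ?u = "block_max v"
  have len: "length v = n" "length ?u = n" by (simp_all add: std_classD(1) [OF v] block_max_def)
  have nth: "?u ! p = Max (?B p)" if "p < n" for p using that by (simp add: block_max_def)
  have fin: "finite (?B p)" for p by simp
  have attained: "\<exists>q<n. packed_word ! q = packed_word ! p \<and> ?u ! p = v ! q" if "p < n" for p
  proof -
    have "Max (?B p) \<in> ?B p" by (rule Max_in [OF fin]) (use that in auto)
    then show ?thesis using nth [OF that] by auto
  qed
  have upper: "v ! q \<le> ?u ! p" if "p < n" "q < n" "packed_word ! q = packed_word ! p" for p q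
    unfolding nth [OF that(1)] by (rule Max_ge [OF fin]) (use that in auto)
  have eq: "?u ! p = ?u ! q" if "p < n" "q < n" "packed_word ! p = packed_word ! q" for p q
    using that by (simp add: nth)
  have above: "?u ! p < v ! q" if pq: "p < n" "q < n" "packed_word ! p < packed_word ! q" for p q
  proof -
    obtain p' where "p' < n" "packed_word ! p' = packed_word ! p" "?u ! p = v ! p'"
      using attained [OF pq(1)] by blast
    then show ?thesis using std_class_block_less [OF v, of p' q] pq by simp
  qed
  have less: "?u ! p < ?u ! q" if "p < n" "q < n" "packed_word ! p < packed_word ! q" for p q
    using above [OF that] upper [OF that(2,2)] by simp
  have iff: "?u ! p < ?u ! q \<longleftrightarrow> packed_word ! p < packed_word ! q" if "p < n" "q < n" for p q
    using less [OF that] less [OF that(2,1)] eq [OF that]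
    by (metis less_asym less_irrefl linorder_neqE_nat)
  then show so: "same_order ?u packed_word" by (simp add: same_order_def len)
  have sub: "set ?u \<subseteq> set v"
  proof
    fix x assume "x \<in> set ?u"
    then obtain p where "p < n" "x = ?u ! p" using len by (auto simp: in_set_conv_nth)
    then show "x \<in> set v" using attained [of p] len by (metis nth_mem)
  qed
  have vs: "set v \<subseteq> {1..n}" by (rule std_classD(2) [OF v])
  with sub show "set ?u \<subseteq> {1..n}" by blast
  show "v \<in> particle_words ?u"
  proof (rule particle_wordsI, unfold len)
    show "v ! p \<le> ?u ! p" if "p < n" for p using upper that by simp
    show "0 < v ! p" if "p < n" for p
    proof -
      have "v ! p \<in> {1..n}" using vs len that by (metis nth_mem subsetD)
      then show ?thesis by simp
    qed
    show "?u ! q < v ! p" if "p < n" "q < n" "?u ! q < ?u ! p" for p q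
      using above [OF that(2,1)] iff [OF that(2,1)] that(3) by simp
    show "v ! p \<le> v ! q" if pq: "p < q" "q < n" "?u ! p = ?u ! q" for p q
    proof -
      have "packed_word ! p = packed_word ! q" using same_order_eq [OF so, of p q] pq by simp
      then show ?thesis using std_class_block_le [OF v] pq by simp
    qed
  qed (use sub in simp_all)
qed

lemma sum_particles_eq_F_sum:
  "(\<Sum>u\<in>{u. same_order u packed_word \<and> set u \<subseteq> {1..n}}. particle u) =
    (F_sum {1..n} n \<sigma> :: nat list \<Rightarrow>\<^sub>0 'k::field_char_0)"
proof -
  let ?U = "{u. same_order u packed_word \<and> set u \<subseteq> {1..n}}" and ?C = "std_class {1..n} n \<sigma>"
  have fin: "finite ?U"
    by (rule finite_subset [of _ "{u. set u \<subseteq> {1..n} \<and> length u = n}"])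
      (auto simp: same_order_def finite_lists_length_eq)
  have fibre: "particle_words u = {v \<in> ?C. block_max v = u}" if "u \<in> ?U" for u
    using that particle_word_in_std_class block_max_eqI block_max_properties(3) by blast
  have "(\<Sum>u\<in>?U. particle u :: nat list \<Rightarrow>\<^sub>0 'k) = (\<Sum>u\<in>?U. \<Sum>v\<in>{v \<in> ?C. block_max v = u}. word v)"
    by (rule sum.cong) (auto simp: particle_def fibre)
  also have "\<dots> = (\<Sum>v\<in>?C. word v)"
    by (rule sum.group [OF finite_std_class fin]) (use block_max_properties in auto)
  finally show ?thesis by (simp add: F_sum_def)
qed

end

theorem theorem3p3:
  fixes \<sigma> :: "nat \<Rightarrow> nat" and n :: nat and r :: "nat list"
  assumes "\<sigma> permutes {1..n}"
    and "reduced_word n (longest_perm n) r"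
  shows "(F_sum {1..n} n \<sigma> :: nat list \<Rightarrow>\<^sub>0 'k::field_char_0) =
           hecke_act (hecke_prod n r) (word (min_word {1..n} n \<sigma>))"
proof -
  let ?u = "packed_word n \<sigma>"
  have "hecke_act (hecke_prod n r) (word ?u) = (foldr qsym_op r (word ?u) :: nat list \<Rightarrow>\<^sub>0 'k)"
    using assms(2) by (intro hecke_act_hecke_prod free_act_hecke_relations) (auto simp: reduced_word_def)
  also have "\<dots> = (\<Sum>v\<in>{v. same_order v ?u \<and> set v \<subseteq> {1..n}}. particle v)"
    by (rule foldr_qsym_op_longest [OF assms(2)])
      (use packed_word_in_class [OF assms(1)] packed_word_closed [OF assms(1)]
        in \<open>auto simp: std_class_def\<close>)
  also have "\<dots> = F_sum {1..n} n \<sigma>"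
    by (rule sum_particles_eq_F_sum [OF assms(1)])
  finally show ?thesis
    unfolding min_word_eq [OF assms(1)] by (rule sym)
qed

end
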